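(* For every integer $n\ge0$, $$c\phi_9(9n+3)\equiv c\phi_9(9n+6)\equiv0\pmod 9,\qquad c\phi_9(3n+1)\equiv0\pmod{81},\qquad c\phi_9(3n+2)\equiv0\pmod{729}.$$
   Context: A $k$-colored generalized Frobenius symbol is a two-row array with $d\ge 0$ columns whose entries are colored nonnegative integers $\ell_c$ ($\ell\ge 0$, color $c\in\{1,\dots,k\}$), each row strictly decreasing with respect to the total order $0_1\prec 0_2\prec\cdots\prec 0_k\prec 1_1\prec\cdots\prec 1_k\prec 2_1\prec\cdots$. It is a $k$-colored generalized Frobenius partition of $n=d+\sum(\text{integer values of all entries})$, and $c\phi_k(n)$ is the number of such partitions of $n$. *)

theory Defs
  imports "HOL-Number_Theory.Cong"
begin

text \<open>A colored nonnegative integer \<open>\<ell>\<^sub>c\<close> is encoded as the pair \<open>(\<ell>, c)\<close>.\<close>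

type_synonym cnat = "nat \<times> nat"

fun cless :: "cnat \<Rightarrow> cnat \<Rightarrow> bool" where
  "cless (l, c) (m, d) \<longleftrightarrow> l < m \<or> l = m \<and> c < d"

definition gf_row :: "nat \<Rightarrow> cnat list \<Rightarrow> bool" where
  "gf_row k xs \<longleftrightarrow> (\<forall>(l, c) \<in> set xs. 1 \<le> c \<and> c \<le> k) \<and> sorted_wrt (\<lambda>x y. cless y x) xs"

definition gf_symbols :: "nat \<Rightarrow> (cnat list \<times> cnat list) set" where
  "gf_symbols k = {(as, bs). length as = length bs \<and> gf_row k as \<and> gf_row k bs}"

fun gf_size :: "cnat list \<times> cnat list \<Rightarrow> nat" where
  "gf_size (as, bs) = length as + (\<Sum>(l, c)\<leftarrow>as. l) + (\<Sum>(l, c)\<leftarrow>bs. l)"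

definition gf_partitions :: "nat \<Rightarrow> nat \<Rightarrow> (cnat list \<times> cnat list) set" where
  "gf_partitions k n = {F \<in> gf_symbols k. gf_size F = n}"

definition cphi :: "nat \<Rightarrow> nat \<Rightarrow> nat" where
  "cphi k n = card (gf_partitions k n)"

text \<open>The cardinality in \<^const>\<open>cphi\<close> is that of a finite set, so it is a genuine count.\<close>

lemma finite_gf_partitions: "finite (gf_partitions k n)"
proof -
  let ?R = "{xs. set xs \<subseteq> {..n} \<times> {..k} \<and> length xs \<le> n}"
  have row: "set xs \<subseteq> {..n} \<times> {..k}"
    if "gf_row k xs" "(\<Sum>(l, c)\<leftarrow>xs. l) \<le> n" for xs
  proof
    fix x assume x: "x \<in> set xs"
    then have "fst x \<le> (\<Sum>(l, c)\<leftarrow>xs. l)"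
      using member_le_sum_list[of "fst x" "map fst xs"] by (simp add: case_prod_unfold)
    then show "x \<in> {..n} \<times> {..k}"
      using that x unfolding gf_row_def by (cases x) fastforce
  qed
  have "gf_partitions k n \<subseteq> ?R \<times> ?R"
  proof
    fix F assume F: "F \<in> gf_partitions k n"
    obtain as bs where "F = (as, bs)" by (cases F)
    with F show "F \<in> ?R \<times> ?R"
      using row[of as] row[of bs] by (simp add: gf_partitions_def gf_symbols_def)
  qed
  moreover have "finite ?R" by (rule finite_lists_length_le) simp
  ultimately show ?thesis by (blast intro: finite_subset)
qed

end

theory Submission
  imports Defs "HOL-Library.Poly_Mapping" "HOL-Library.Product_Lexorder"
    "HOL-Computational_Algebra.Formal_Laurent_Series" Complex_Main
begin

text \<open>
  The generating function of \<open>c\<phi>\<^sub>9\<close> is the constant term in \<open>z\<close> of \<open>F(z)\<^sup>9\<close> with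
  \<open>F(z) = \<Prod>(1 + z q\<^sup>n\<^sup>+\<^sup>1)(1 + z\<^sup>-\<^sup>1 q\<^sup>n)\<close>.
  By the Jacobi triple product it equals \<open>\<Theta> / E\<^sub>1\<^sup>9\<close>, where \<open>\<Theta>\<close> is
  the theta series of the root lattice \<open>A\<^sub>8\<close> and \<open>E\<^sub>m = \<Prod>(1 - q\<^sup>m\<^sup>k)\<close>. Splitting nine coordinates
  into three triples writes \<open>\<Theta>\<close> through the cubic theta functions: \<open>\<Theta> = a\<^sup>3x + 54K(a + 3Y)\<close>, where
  \<open>x(q) = a(q\<^sup>3)\<close>, \<open>w = E\<^sub>3\<^sup>3 / E\<^sub>1\<close>, \<open>K = q w\<^sup>3\<close>, \<open>Y = q w(q\<^sup>3)\<close>. Moreover \<open>a = x + 6Y\<close>, and \<open>b = x - 3Y\<close>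
  equals \<open>E\<^sub>1\<^sup>3 / E\<^sub>3\<close>, as one sees from \<open>F(z) F(\<omega>z) F(\<omega>\<^sup>2z) = F(z\<^sup>3; q\<^sup>3)\<close> for a cube root of unity \<open>\<omega>\<close>.

  Since \<open>a \<equiv> b (mod 9)\<close> and \<open>b \<equiv> 1 (mod 3)\<close>, this collapses to
  \<open>x / E\<^sub>3\<^sup>3 + 81 q E\<^sub>3\<^sup>5 (mod 729)\<close>. The first term is a series in \<open>q\<^sup>3\<close> which is congruent to \<open>1 / E\<^sub>9\<close>
  modulo 9, and the second one has only exponents congruent to 1 modulo 3.
\<close>

unbundle fps_syntax

section \<open>Weighted generating series and infinite products\<close>

text \<open>Without gradedness \<open>gen\<close> is junk: a sum over an infinite fibre is 0.\<close>

definition graded :: "'s set \<Rightarrow> ('s \<Rightarrow> int) \<Rightarrow> bool" where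
  "graded S w \<longleftrightarrow> (\<forall>s\<in>S. 0 \<le> w s) \<and> (\<forall>n. finite {s \<in> S. w s = int n})"

definition gen :: "'s set \<Rightarrow> ('s \<Rightarrow> int) \<Rightarrow> ('s \<Rightarrow> 'a) \<Rightarrow> 'a::comm_ring_1 fps" where
  "gen S w \<chi> = Abs_fps (\<lambda>n. \<Sum>s | s \<in> S \<and> w s = int n. \<chi> s)"

lemma gen_nth: "gen S w \<chi> $ n = (\<Sum>s | s \<in> S \<and> w s = int n. \<chi> s)"
  by (simp add: gen_def)

lemma graded_subset: "graded S w \<Longrightarrow> T \<subseteq> S \<Longrightarrow> graded T w"
proof -
  assume *: "graded S w" "T \<subseteq> S"
  have "finite {s \<in> T. w s = int n}" for n
    by (rule finite_subset[of _ "{s \<in> S. w s = int n}"]) (use * in \<open>auto simp: graded_def\<close>)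
  with * show ?thesis by (auto simp: graded_def)
qed

lemma graded_Times:
  assumes "graded S w" "graded T v"
  shows "graded (S \<times> T) (\<lambda>(s, t). w s + v t)"
proof -
  have "finite {p \<in> S \<times> T. (case p of (s, t) \<Rightarrow> w s + v t) = int n}" for n
  proof (rule finite_subset)
    show "{p \<in> S \<times> T. (case p of (s, t) \<Rightarrow> w s + v t) = int n}
      \<subseteq> (\<Union>i\<le>n. {s \<in> S. w s = int i} \<times> {t \<in> T. v t = int (n - i)})"
    proof safe
      fix s t assume "s \<in> S" "t \<in> T" "w s + v t = int n"
      moreover from this assms have "0 \<le> w s" "0 \<le> v t"
        by (auto simp: graded_def)
      ultimately show "(s, t) \<in> (\<Union>i\<le>n. {s \<in> S. w s = int i} \<times> {t \<in> T. v t = int (n - i)})"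
        by (intro UN_I[of "nat (w s)"]) auto
    qed
    show "finite (\<Union>i\<le>n. {s \<in> S. w s = int i} \<times> {t \<in> T. v t = int (n - i)})"
      using assms by (intro finite_UN_I finite_cartesian_product) (auto simp: graded_def simp del:
          of_nat_diff)
  qed
  with assms show ?thesis by (auto simp: graded_def)
qed

lemma gen_Times:
  assumes "graded S w" "graded T v"
  shows "gen (S \<times> T) (\<lambda>(s, t). w s + v t) (\<lambda>(s, t). \<chi> s * \<psi> t) = gen S w \<chi> * gen T v \<psi>"
proof (rule fps_ext)
  fix n
  let ?S = "\<lambda>i. {s \<in> S. w s = int i}" and ?T = "\<lambda>i. {t \<in> T. v t = int i}"
  have fin: "finite (?S i)" "finite (?T i)" for i
    using assms by (auto simp: graded_def)
  have eq: "{p \<in> S \<times> T. (case p of (s, t) \<Rightarrow> w s + v t) = int n} = (\<Union>i\<in>{0..n}. ?S i \<times> ?T (n - i))"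
  proof safe
    fix s t assume "s \<in> S" "t \<in> T" "w s + v t = int n"
    moreover from this assms have "0 \<le> w s" "0 \<le> v t"
      by (auto simp: graded_def)
    ultimately show "(s, t) \<in> (\<Union>i\<in>{0..n}. ?S i \<times> ?T (n - i))"
      by (intro UN_I[of "nat (w s)"]) auto
  qed auto
  have "gen (S \<times> T) (\<lambda>(s, t). w s + v t) (\<lambda>(s, t). \<chi> s * \<psi> t) $ n =
      (\<Sum>i=0..n. \<Sum>(s, t)\<in>?S i \<times> ?T (n - i). \<chi> s * \<psi> t)"
    unfolding gen_nth eq
    by (intro sum.UNION_disjoint ballI finite_cartesian_product fin) auto
  also have "\<dots> = (\<Sum>i=0..n. gen S w \<chi> $ i * gen T v \<psi> $ (n - i))"
    by (simp add: gen_nth sum_product sum.cartesian_product)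
  finally show "gen (S \<times> T) (\<lambda>(s, t). w s + v t) (\<lambda>(s, t). \<chi> s * \<psi> t) $ n =
      (gen S w \<chi> * gen T v \<psi>) $ n"
    by (simp add: fps_mult_nth)
qed

lemma graded_Times3:
  assumes "graded S w" "graded T v" "graded U u"
  shows "graded (S \<times> T \<times> U) (\<lambda>(s, t, r). w s + v t + u r)"
  using graded_Times[OF assms(1) graded_Times[OF assms(2,3)]]
  by (simp add: case_prod_unfold add.assoc)

lemma gen_Times3:
  assumes "graded S w" "graded T v" "graded U u"
  shows "gen S w \<chi> * gen T v \<psi> * gen U u \<phi> =
    gen (S \<times> T \<times> U) (\<lambda>(s, t, r). w s + v t + u r) (\<lambda>(s, t, r). \<chi> s * \<psi> t * \<phi> r)"
  using gen_Times[OF assms(1) graded_Times[OF assms(2,3)], of \<chi> "\<lambda>(t, r). \<psi> t * \<phi> r"]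
  unfolding gen_Times[OF assms(2,3)] by (simp add: case_prod_unfold mult.assoc add.assoc)

text \<open>The maps \<open>f\<close> and \<open>g\<close> are mutually inverse, and
  \<open>f\<close> respects weights and coefficients. The lattice identities below are obtained by
  exhibiting such a pair.\<close>

lemma gen_reindex:
  assumes "\<And>s. s \<in> S \<Longrightarrow> f s \<in> T \<and> g (f s) = s \<and> v (f s) = w s \<and> \<psi> (f s) = \<chi> s"
    and "\<And>t. t \<in> T \<Longrightarrow> g t \<in> S \<and> f (g t) = t"
  shows "gen S w \<chi> = gen T v \<psi>"
proof (rule fps_ext)
  fix n
  show "gen S w \<chi> $ n = gen T v \<psi> $ n"
    unfolding gen_nth
    by (rule sum.reindex_bij_witness[where j = f and i = g]) (use assms in force)+
qed

lemma gen_cong: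
  assumes "S = T" "\<And>s. s \<in> S \<Longrightarrow> w s = v s" "\<And>s. s \<in> S \<Longrightarrow> \<chi> s = \<psi> s"
  shows "gen S w \<chi> = gen T v \<psi>"
  using assms by (intro gen_reindex[where f = id and g = id]) auto

lemma gen_Un:
  assumes "graded (S \<union> T) w" "S \<inter> T = {}"
  shows "gen (S \<union> T) w \<chi> = gen S w \<chi> + gen T w \<chi>"
proof (rule fps_ext)
  fix n
  have "finite {s \<in> S. w s = int n}" "finite {s \<in> T. w s = int n}"
    using graded_subset[OF assms(1)] by (auto simp: graded_def)
  then show "gen (S \<union> T) w \<chi> $ n = (gen S w \<chi> + gen T w \<chi>) $ n"
    using assms(2) unfolding gen_nth fps_add_nth
    by (subst sum.union_disjoint[symmetric]) (auto intro!: sum.cong)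
qed

lemma gen_scale: "fps_const c * gen S w \<chi> = gen S w (\<lambda>s. c * \<chi> s)"
  by (rule fps_ext) (simp add: gen_nth sum_distrib_left)

text \<open>Nonnegativity matters: an element of negative weight is invisible to
  \<open>gen S w\<close> but could become visible after the shift.\<close>

lemma gen_shift:
  assumes "\<And>s. s \<in> S \<Longrightarrow> 0 \<le> w s"
  shows "fps_X ^ k * gen S w \<chi> = gen S (\<lambda>s. w s + int k) \<chi>"
proof (rule fps_ext)
  fix n
  show "(fps_X ^ k * gen S w \<chi>) $ n = gen S (\<lambda>s. w s + int k) \<chi> $ n"
  proof (cases "n < k")
    case True
    with assms have "{s \<in> S. w s + int k = int n} = {}" by force
    with True show ?thesis by (simp only: gen_nth fps_X_power_mult_nth) simp
  next
    case False
    then show ?thesis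
      by (auto simp: gen_nth fps_X_power_mult_nth intro!: sum.cong)
  qed
qed

lemma gen_dilate:
  fixes \<chi> :: "'s \<Rightarrow> 'a::idom"
  shows "gen S w \<chi> oo fps_X ^ 3 = gen S (\<lambda>s. 3 * w s) \<chi>"
proof (rule fps_ext)
  fix n
  have "{s \<in> S. 3 * w s = int n} = (if 3 dvd n then {s \<in> S. w s = int (n div 3)} else {})"
    by (auto; presburger)
  then show "(gen S w \<chi> oo fps_X ^ 3) $ n = gen S (\<lambda>s. 3 * w s) \<chi> $ n"
    by (simp add: gen_nth fps_nth_compose_X_power)
qed

section \<open>Truncation of power series and infinite products\<close>

definition cong_X :: "nat \<Rightarrow> 'a fps \<Rightarrow> 'a fps \<Rightarrow> bool" where
  "cong_X N f g \<longleftrightarrow> (\<forall>i<N. f $ i = g $ i)"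

lemma cong_X_refl [simp]: "cong_X N f f"
  by (simp add: cong_X_def)

lemma cong_X_sym: "cong_X N f g \<Longrightarrow> cong_X N g f"
  by (simp add: cong_X_def)

lemma cong_X_trans [trans]: "cong_X N f g \<Longrightarrow> cong_X N g h \<Longrightarrow> cong_X N f h"
  by (simp add: cong_X_def)

lemma cong_X_mono: "cong_X N f g \<Longrightarrow> M \<le> N \<Longrightarrow> cong_X M f g"
  by (simp add: cong_X_def)

lemma cong_X_mult:
  fixes f g f' g' :: "'a::comm_ring_1 fps"
  shows "cong_X N f g \<Longrightarrow> cong_X N f' g' \<Longrightarrow> cong_X N (f * f') (g * g')"
  by (auto simp: cong_X_def fps_mult_nth intro!: sum.cong)

lemma cong_X_sum:
  fixes f g :: "'i \<Rightarrow> 'a::comm_ring_1 fps"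
  shows "(\<And>i. i \<in> I \<Longrightarrow> cong_X N (f i) (g i)) \<Longrightarrow> cong_X N (sum f I) (sum g I)"
  by (auto simp: cong_X_def fps_sum_nth intro!: sum.cong)

lemma cong_X_mult_X_power:
  fixes f g :: "'a::comm_ring_1 fps"
  assumes "cong_X N f g"
  shows "cong_X (N + k) (f * fps_X ^ k) (g * fps_X ^ k)"
  using assms by (auto simp: cong_X_def fps_X_power_mult_right_nth)

lemma cong_X_X_power:
  fixes f g :: "'a::comm_ring_1 fps"
  assumes "N \<le> k"
  shows "cong_X N (f + g * fps_X ^ k) f" 
  using assms by (auto simp: cong_X_def fps_X_power_mult_right_nth)

text \<open>Since \<open>p k\<close> differs from 1 only from degree k on, the coefficient of q^n in
  the product is settled by the factors up to index n. This gives \<open>iprod\<close> its meaning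
  without a limit.\<close>

definition tame :: "(nat \<Rightarrow> 'a::comm_ring_1 fps) \<Rightarrow> bool" where
  "tame p \<longleftrightarrow> (\<forall>k. cong_X k (p k) 1)"

definition iprod :: "(nat \<Rightarrow> 'a::comm_ring_1 fps) \<Rightarrow> 'a fps" where
  "iprod p = Abs_fps (\<lambda>n. (\<Prod>k\<le>n. p k) $ n)"

lemma iprod_cong_X':
  assumes "tame p" "\<And>k. m \<le> k \<Longrightarrow> cong_X N (p k) 1"
  shows "cong_X N (iprod p) (\<Prod>k<m. p k)"
  unfolding cong_X_def
proof (intro allI impI)
  fix n assume "n < N"
  have ext: "(\<Prod>k<a + d. p k) $ n = (\<Prod>k<a. p k) $ n" if "\<And>k. a \<le> k \<Longrightarrow> cong_X (Suc n) (p k) 1" for a d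
  proof -
    have "cong_X (Suc n) (\<Prod>k<a + d. p k) (\<Prod>k<a. p k)"
    proof (induction d)
      case (Suc d)
      have "cong_X (Suc n) ((\<Prod>k<a + d. p k) * p (a + d)) ((\<Prod>k<a. p k) * 1)"
        using Suc.IH that[of "a + d"] by (intro cong_X_mult) auto
      then show ?case by simp
    qed simp
    then show ?thesis by (simp add: cong_X_def)
  qed
  have "iprod p $ n = (\<Prod>k<Suc n. p k) $ n"
    by (simp add: iprod_def lessThan_Suc_atMost)
  \<comment> \<open>Both partial products are extended to the common length
    \<open>Suc n + m\<close>: tameness justifies one extension, the second hypothesis the
    other.\<close>
  also have "\<dots> = (\<Prod>k<Suc n + m. p k) $ n"
    using assms(1) by (intro ext[symmetric]) (auto simp: tame_def intro: cong_X_mono)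
  also have "\<dots> = (\<Prod>k<m + Suc n. p k) $ n"
    by (simp add: add.commute)
  also have "\<dots> = (\<Prod>k<m. p k) $ n"
    using \<open>n < N\<close> by (intro ext cong_X_mono[OF assms(2)]) auto
  finally show "iprod p $ n = (\<Prod>k<m. p k) $ n" .
qed

lemma iprod_cong_X: "tame p \<Longrightarrow> cong_X N (iprod p) (\<Prod>k<N. p k)"
  by (rule iprod_cong_X') (auto simp: tame_def intro: cong_X_mono)

lemma cong_X_all_imp_eq: "(\<And>N. cong_X N f g) \<Longrightarrow> f = g"
  by (auto simp: cong_X_def fps_eq_iff)

lemma tame_mult: "tame p \<Longrightarrow> tame q \<Longrightarrow> tame (\<lambda>k. p k * q k)"
  unfolding tame_def using cong_X_mult by (metis mult_1)

lemma iprod_mult: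
  assumes "tame p" "tame q"
  shows "iprod (\<lambda>k. p k * q k) = iprod p * iprod q"
proof (rule cong_X_all_imp_eq)
  fix N
  have "cong_X N (iprod (\<lambda>k. p k * q k)) (\<Prod>k<N. p k * q k)"
    using assms by (intro iprod_cong_X tame_mult)
  also have "(\<Prod>k<N. p k * q k) = (\<Prod>k<N. p k) * (\<Prod>k<N. q k)"
    by (rule prod.distrib)
  also have "cong_X N \<dots> (iprod p * iprod q)"
    using assms by (intro cong_X_mult cong_X_sym[OF iprod_cong_X])
  finally show "cong_X N (iprod (\<lambda>k. p k * q k)) (iprod p * iprod q)" .
qed

lemma tame_power: "tame p \<Longrightarrow> tame (\<lambda>k. p k ^ m)"
  by (induction m) (auto intro: tame_mult, simp add: tame_def)

lemma iprod_power:
  assumes "tame p"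
  shows "iprod (\<lambda>k. p k ^ m) = iprod p ^ m"
proof (induction m)
  case 0
  show ?case by (rule fps_ext) (simp add: iprod_def)
next
  case (Suc m)
  then show ?case using iprod_mult[OF assms tame_power[OF assms, of m]] by simp
qed

lemma iprod_trisect:
  assumes "tame p" "tame (\<lambda>k. p (3 * k) * p (3 * k + 1) * p (3 * k + 2))"
  shows "iprod p = iprod (\<lambda>k. p (3 * k) * p (3 * k + 1) * p (3 * k + 2))"
proof (rule cong_X_all_imp_eq)
  fix N
  have "(\<Prod>k<3 * N. p k) = (\<Prod>k<N. p (3 * k) * p (3 * k + 1) * p (3 * k + 2))"
    by (induction N) (simp_all add: mult.assoc eval_nat_numeral)
  then show "cong_X N (iprod p) (iprod (\<lambda>k. p (3 * k) * p (3 * k + 1) * p (3 * k + 2)))"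
    using cong_X_mono[OF iprod_cong_X[OF assms(1), of "3 * N"], of N]
      cong_X_sym[OF iprod_cong_X[OF assms(2), of N]]
    by (auto intro: cong_X_trans)
qed

lemma fps_right_inverse_exists:
  fixes f :: "'a::comm_ring_1 fps"
  assumes "f $ 0 = 1"
  obtains g where "f * g = 1"
  using fps_right_inverse[of f 1] assms by auto

definition euler :: "nat \<Rightarrow> 'a::comm_ring_1 fps" where
  "euler m = iprod (\<lambda>k. 1 - fps_X ^ (m * (k + 1)))"

lemma cong_X_one_plus: "N \<le> k \<Longrightarrow> cong_X N (1 + fps_const c * fps_X ^ k :: 'a::comm_ring_1 fps) 1"
  using cong_X_X_power[of N k 1 "fps_const c"] by simp

lemma cong_X_one_minus: "N \<le> k \<Longrightarrow> cong_X N (1 - fps_X ^ k :: 'a::comm_ring_1 fps) 1"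
  using cong_X_X_power[of N k 1 "-1"] by simp

lemma tame_euler: "m \<ge> 1 \<Longrightarrow> tame (\<lambda>k. 1 - fps_X ^ (m * (k + 1)))"
  unfolding tame_def by (auto intro!: cong_X_one_minus simp: trans_le_add2)

lemma euler_nth_0: "m \<ge> 1 \<Longrightarrow> euler m $ 0 = 1"
  by (simp add: euler_def iprod_def)

section \<open>The Jacobi triple product\<close>

text \<open>The Gaussian binomial coefficient, given by a q-Pascal rule so that no division occurs
  and \<open>q\<close> may lie in any commutative ring.\<close>

fun qbinom :: "'a::comm_ring_1 \<Rightarrow> nat \<Rightarrow> nat \<Rightarrow> 'a" where
  "qbinom q M 0 = 1"
| "qbinom q 0 (Suc k) = 0"
| "qbinom q (Suc M) (Suc k) = qbinom q M (Suc k) + q ^ (M - k) * qbinom q M k"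

lemma qbinom_eq_0: "k > M \<Longrightarrow> qbinom q M k = 0"
  by (induction q M k rule: qbinom.induct) auto

text \<open>The other q-Pascal rule. In the finite triple product the defining rule absorbs a new
  factor in \<open>u\<close>, and this one a new factor in \<open>v\<close>.\<close>

lemma qbinom_Suc_Suc':
  "qbinom q (Suc M) (Suc k) = qbinom q M k + q ^ Suc k * qbinom q M (Suc k)"
proof (induction M arbitrary: k)
  case 0
  then show ?case by (cases k) auto
next
  case (Suc M)
  show ?case
  proof (cases "k \<le> M")
    case False
    then show ?thesis using qbinom_eq_0[of M k q] qbinom_eq_0[of M "Suc k" q] 
      by (auto simp: not_le qbinom_eq_0)
  next
    case True
    show ?thesis
    proof (cases k)
      case 0
      have "qbinom q (Suc (Suc M)) (Suc k) = qbinom q (Suc M) (Suc 0) + q ^ Suc M"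
        by (simp add: 0)
      also have "qbinom q (Suc M) (Suc 0) = 1 + q * qbinom q M (Suc 0)"
        using Suc.IH[of 0] by simp
      also have "1 + q * qbinom q M (Suc 0) + q ^ Suc M = 1 + q * qbinom q (Suc M) (Suc 0)"
        by (simp add: algebra_simps)
      finally show ?thesis by (simp add: 0)
    next
      case (Suc l)
      have e: "q ^ (Suc M - k) * q ^ k = q ^ Suc k * q ^ (M - k)" "M - l = Suc M - k"
        using True Suc by (simp_all flip: power_add power_Suc)
      have "qbinom q (Suc (Suc M)) (Suc k) =
          qbinom q (Suc M) (Suc k) + q ^ (Suc M - k) * qbinom q (Suc M) (Suc l)"
        by (simp add: Suc)
      also have "\<dots> = qbinom q M k + q ^ Suc k * qbinom q M (Suc k)
          + q ^ (Suc M - k) * (qbinom q M l + q ^ k * qbinom q M k)"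
        using Suc.IH[of k] Suc.IH[of l] Suc by simp
      also have "\<dots> = qbinom q M k + q ^ (Suc M - k) * qbinom q M l
          + q ^ Suc k * qbinom q M (Suc k) + (q ^ (Suc M - k) * q ^ k) * qbinom q M k"
        by (simp only: algebra_simps)
      also have "\<dots> = qbinom q (Suc M) k + q ^ Suc k * qbinom q (Suc M) (Suc k)"
        unfolding e(1) by (simp add: Suc e(2)[symmetric] algebra_simps del: power_Suc)
      finally show ?thesis .
    qed
  qed
qed

definition qpoch :: "'a::comm_ring_1 \<Rightarrow> nat \<Rightarrow> 'a" where
  "qpoch q n = (\<Prod>i<n. 1 - q ^ Suc i)"

lemma qpoch_0 [simp]: "qpoch q 0 = 1"
  and qpoch_Suc: "qpoch q (Suc n) = qpoch q n * (1 - q ^ Suc n)"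
  by (simp_all add: qpoch_def)

text \<open>The quotient formula with denominators cleared. The two terms of the recurrence combine
  through 1 - q^(M+1) = (1 - q^(M-k)) + q^(M-k) (1 - q^(k+1)).\<close>

lemma qbinom_qpoch: "k \<le> M \<Longrightarrow> qbinom q M k * qpoch q k * qpoch q (M - k) = qpoch q M"
proof (induction q M k rule: qbinom.induct)
  case (3 q M k)
  show ?case
  proof (cases "k = M")
    case True
    then show ?thesis using 3 by (simp add: qbinom_eq_0 qpoch_Suc mult.assoc[symmetric])
  next
    case False
    then have k: "Suc k \<le> M" using 3 by auto
    then have s: "Suc M - Suc k = Suc (M - Suc k)" "M - k = Suc (M - Suc k)" by auto
    have p: "q ^ (M - k) * q ^ Suc k = q ^ Suc M"
      using k by (simp flip: power_add power_Suc)
    have "qbinom q (Suc M) (Suc k) * qpoch q (Suc k) * qpoch q (Suc M - Suc k) =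
       (qbinom q M (Suc k) * qpoch q (Suc k) * qpoch q (M - Suc k)) * (1 - q ^ (M - k))
        + q ^ (M - k) * (1 - q ^ Suc k) * (qbinom q M k * qpoch q k * qpoch q (M - k))"
      unfolding qbinom.simps s qpoch_Suc by (simp only: algebra_simps)
    also have "\<dots> = qpoch q M * (1 - q ^ (M - k)) + q ^ (M - k) * (1 - q ^ Suc k) * qpoch q M"
      using "3.IH" k by simp
    also have "\<dots> = qpoch q M * (1 - q ^ (M - k) * q ^ Suc k)"
      by (simp add: algebra_simps)
    finally show ?thesis unfolding p qpoch_Suc .
  qed
qed auto

text \<open>Formally u v = q and \<open>t s\<close> is u^s q^(s(s-1)/2). To avoid negative powers,
  \<open>t\<close> enters only through its recurrences, where the bounds on \<open>n\<close> keep
  the exponents of \<open>q\<close> nonnegative.\<close>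

lemma finite_jacobi_triple:
  fixes u v q :: "'a::comm_ring_1" and t :: "int \<Rightarrow> 'a"
  assumes t0: "t 0 = 1"
    and up: "\<And>s n. s \<le> int n \<Longrightarrow> u * q ^ n * t s = q ^ nat (int n - s) * t (s + 1)"
    and down: "\<And>s n. - s \<le> int n \<Longrightarrow> v * q ^ n * t s = q ^ nat (int n + s) * t (s - 1)"
  shows "(\<Prod>n<A. 1 + u * q ^ n) * (\<Prod>n<B. 1 + v * q ^ n) =
    (\<Sum>k\<le>A + B. qbinom q (A + B) k * t (int k - int B))"
proof (induction B)
  case 0
  have "(\<Prod>n<A. 1 + u * q ^ n) = (\<Sum>k\<le>A. qbinom q A k * t (int k))"
  proof (induction A)
    case 0
    show ?case by (simp add: t0)
  next
    case (Suc A)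
    have "(\<Prod>n<Suc A. 1 + u * q ^ n) =
        (\<Sum>k\<le>A. qbinom q A k * t (int k)) + (\<Sum>k\<le>A. qbinom q A k * (u * q ^ A * t (int k)))"
      by (simp add: Suc.IH algebra_simps sum_distrib_left sum.distrib)
    also have "(\<Sum>k\<le>A. qbinom q A k * (u * q ^ A * t (int k))) =
        (\<Sum>k\<le>A. q ^ (A - k) * qbinom q A k * t (int (Suc k)))"
      by (intro sum.cong refl, subst up) (simp_all add: nat_diff_distrib' mult_ac add.commute)
    also have "(\<Sum>k\<le>A. qbinom q A k * t (int k)) = (\<Sum>k\<le>Suc A. qbinom q A k * t (int k))"
      by (simp add: qbinom_eq_0)
    also have "\<dots> = t 0 + (\<Sum>k\<le>A. qbinom q A (Suc k) * t (int (Suc k)))"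
      by (subst sum.atMost_Suc_shift) simp
    also have "\<dots> + (\<Sum>k\<le>A. q ^ (A - k) * qbinom q A k * t (int (Suc k))) =
        t 0 + (\<Sum>k\<le>A. qbinom q (Suc A) (Suc k) * t (int (Suc k)))"
      by (simp add: algebra_simps sum.distrib)
    also have "\<dots> = (\<Sum>k\<le>Suc A. qbinom q (Suc A) k * t (int k))"
      by (subst sum.atMost_Suc_shift) simp
    finally show ?case .
  qed
  then show ?case by simp
next
  case (Suc B)
  let ?M = "A + B"
  have "(\<Prod>n<A. 1 + u * q ^ n) * (\<Prod>n<Suc B. 1 + v * q ^ n) =
      (\<Sum>k\<le>?M. qbinom q ?M k * t (int k - int B)) * (1 + v * q ^ B)"
    unfolding Suc.IH[symmetric] by (simp add: mult.assoc)
  also have "\<dots> = (\<Sum>k\<le>?M. qbinom q ?M k * t (int k - int B)) +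
      (\<Sum>k\<le>?M. qbinom q ?M k * (v * q ^ B * t (int k - int B)))"
    by (simp add: algebra_simps sum_distrib_left sum.distrib)
  also have "(\<Sum>k\<le>?M. qbinom q ?M k * (v * q ^ B * t (int k - int B))) =
      (\<Sum>k\<le>?M. q ^ k * qbinom q ?M k * t (int k - int (Suc B)))"
    by (intro sum.cong refl, subst down) (simp_all add: mult_ac algebra_simps)
  also have "\<dots> = (\<Sum>k\<le>Suc ?M. q ^ k * qbinom q ?M k * t (int k - int (Suc B)))"
    by (simp add: qbinom_eq_0)
  also have "\<dots> = t (- int (Suc B)) + (\<Sum>k\<le>?M. q ^ Suc k * qbinom q ?M (Suc k) * t (int k - int B))"
    by (subst sum.atMost_Suc_shift) simp
  also have "(\<Sum>k\<le>?M. qbinom q ?M k * t (int k - int B)) + \<dots> =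
      t (- int (Suc B)) + (\<Sum>k\<le>?M. qbinom q (Suc ?M) (Suc k) * t (int k - int B))"
    unfolding qbinom_Suc_Suc' by (simp add: algebra_simps sum.distrib del: power_Suc)
  also have "\<dots> = (\<Sum>k\<le>Suc ?M. qbinom q (Suc ?M) k * t (int k - int (Suc B)))"
    by (subst sum.atMost_Suc_shift) simp
  finally show ?case by simp
qed

section \<open>Triangular exponents and the infinite triple product\<close>

definition tri :: "int \<Rightarrow> int" where
  "tri s = s * (s + 1) div 2"

lemma two_tri: "2 * tri s = s * (s + 1)"
  by (simp add: tri_def)

lemma tri_0 [simp]: "tri 0 = 0"
  by (simp add: tri_def)

lemma tri_add1: "tri (s + 1) = tri s + s + 1"
  using two_tri[of s] two_tri[of "s + 1"] by (simp add: algebra_simps)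

lemma tri_add1': "tri (1 + s) = tri s + s + 1"
  using tri_add1[of s] by (simp only: add.commute)

lemma tri_diff1: "tri (s - 1) = tri s - s"
  using tri_add1[of "s - 1"] by simp

text \<open>For fixed \<open>s\<close> the weight is linear in \<open>g\<close>, hence smallest at g
  = a for positive \<open>s\<close> and at g = 0 for negative \<open>s\<close>; in both cases twice
  the weight is a |s| (|s| - 1). The bound |s| - 1 makes the fibres finite and controls the
  truncation in the triple product.\<close>

lemma abs_le_tri_weight:
  fixes a g s :: int
  assumes "1 \<le> a" "0 \<le> g" "g \<le> a"
  shows "\<bar>s\<bar> - 1 \<le> a * tri s - g * s" "0 \<le> a * tri s - g * s"
proof -
  have "\<bar>s\<bar> * (\<bar>s\<bar> - 1) \<le> 2 * (a * tri s - g * s)"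
  proof (cases "s \<ge> 0")
    case True
    then have "0 \<le> s * (s - 1)" by (cases "s = 0") auto
    then have "1 * (s * (s - 1)) \<le> a * (s * (s - 1))"
      using assms by (intro mult_right_mono) auto
    also have "\<dots> = a * (2 * tri s) - 2 * (a * s)"
      unfolding two_tri by (simp add: algebra_simps)
    also have "\<dots> \<le> a * (2 * tri s) - 2 * (g * s)"
      using assms True by (simp add: mult_right_mono)
    finally show ?thesis using True by (simp add: algebra_simps)
  next
    case False
    then have "0 \<le> s * (s + 1)" by (simp add: mult_nonpos_nonpos)
    then have "1 * (s * (s + 1)) \<le> a * (s * (s + 1))"
      using assms by (intro mult_right_mono) auto
    also have "\<dots> = a * (2 * tri s)" by (simp add: two_tri)
    also have "\<dots> \<le> a * (2 * tri s) - 2 * (g * s)"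
      using assms False by (simp add: mult_nonneg_nonpos)
    finally show ?thesis using False by (simp add: algebra_simps)
  qed
  moreover have "2 * (\<bar>s\<bar> - 1) \<le> \<bar>s\<bar> * (\<bar>s\<bar> - 1)" if "\<bar>s\<bar> \<ge> 2"
    using that by (intro mult_right_mono) auto
  moreover have "s = 0 \<or> \<bar>s\<bar> = 1 \<or> \<bar>s\<bar> \<ge> 2" by arith
  ultimately show "\<bar>s\<bar> - 1 \<le> a * tri s - g * s" by force
  show "0 \<le> a * tri s - g * s"
  proof (cases "s = 0")
    case False
    then have "0 \<le> \<bar>s\<bar> * (\<bar>s\<bar> - 1)" by (intro mult_nonneg_nonneg) auto
    also note \<open>\<bar>s\<bar> * (\<bar>s\<bar> - 1) \<le> 2 * (a * tri s - g * s)\<close>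
    finally show ?thesis by simp
  qed simp
qed

lemma graded_tri:
  assumes "1 \<le> a" "0 \<le> g" "g \<le> a"
  shows "graded UNIV (\<lambda>s. a * tri s - g * s)"
  unfolding graded_def
proof (intro conjI allI ballI)
  fix n
  show "finite {s \<in> UNIV. a * tri s - g * s = int n}"
  proof (rule finite_subset)
    show "{s \<in> UNIV. a * tri s - g * s = int n} \<subseteq> {- (int n + 1)..int n + 1}"
    proof
      fix s assume "s \<in> {s \<in> UNIV. a * tri s - g * s = int n}"
      then show "s \<in> {- (int n + 1)..int n + 1}"
        using abs_le_tri_weight(1)[OF assms, of s] by auto
    qed
  qed auto
qed (use abs_le_tri_weight(2)[OF assms] in auto)

definition theta :: "int \<Rightarrow> int \<Rightarrow> (int \<Rightarrow> 'a) \<Rightarrow> 'a::comm_ring_1 fps" where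
  "theta a g \<zeta> = gen UNIV (\<lambda>s. a * tri s - g * s) \<zeta>"

text \<open>In all uses \<open>\<zeta>\<close> is a character of the integers, standing for the
  powers of z, of z^3, or of z times a root of unity. For \<open>a = 1\<close>, \<open>g = 0\<close>
  and \<open>\<zeta> = zpow\<close> this is F(z).\<close>

definition jacobi :: "nat \<Rightarrow> nat \<Rightarrow> (int \<Rightarrow> 'a) \<Rightarrow> 'a::comm_ring_1 fps" where
  "jacobi a g \<zeta> = iprod (\<lambda>k. (1 + fps_const (\<zeta> 1) * fps_X ^ (a * k + (a - g))) *
      (1 + fps_const (\<zeta> (-1)) * fps_X ^ (a * k + g)))"

lemma tame_jacobi:
  assumes "1 \<le> a"
  shows "tame (\<lambda>k. (1 + fps_const c * fps_X ^ (a * k + b)) * (1 + fps_const d * fps_X ^ (a * k + e)))"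
  using assms by (intro tame_mult) (auto simp: tame_def intro!: cong_X_one_plus trans_le_add1)

text \<open>The first omitted factor is 1 - q^(a(m+1)), so the agreement reaches one order beyond
  the number of factors. The proof of \<open>jacobi_triple\<close> uses this extra order.\<close>

lemma qpoch_cong_euler:
  assumes "1 \<le> a"
  shows "cong_X (Suc m) (euler a) (qpoch (fps_X ^ a) m)"
proof -
  have "cong_X (Suc m) (euler a) (\<Prod>k<m. 1 - fps_X ^ (a * (k + 1)) :: 'a fps)"
    unfolding euler_def using assms
    by (intro iprod_cong_X' tame_euler cong_X_one_minus)
       (auto intro: order_trans[of _ "Suc _"] mult_le_mono[of 1 a, simplified])
  then show ?thesis by (simp add: qpoch_def power_add power_mult)
qed

text \<open>By \<open>qbinom_qpoch\<close> the coefficient is a quotient of three finite products,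
  each agreeing with \<open>euler a\<close> to the stated order; so it approximates the inverse of
  \<open>euler a\<close>.\<close>

lemma qbinom_euler:
  assumes "1 \<le> a" "k \<le> M" "m \<le> k" "m \<le> M - k"
  shows "cong_X (Suc m) (qbinom (fps_X ^ a) M k * euler a) (1 :: 'a::comm_ring_1 fps)"
proof -
  let ?b = "qbinom (fps_X ^ a) M k :: 'a fps" and ?q = "qpoch (fps_X ^ a) :: nat \<Rightarrow> 'a fps"
  obtain h :: "'a fps" where h: "euler a * h = 1"
    using fps_right_inverse_exists[OF euler_nth_0[OF assms(1)]] by blast
  have E: "cong_X (Suc m) (euler a) (?q n)" if "m \<le> n" for n
    by (rule cong_X_mono[OF qpoch_cong_euler[OF assms(1), of n]]) (use that in simp)
  have "cong_X (Suc m) (?b * euler a * euler a * h) (?b * ?q k * ?q (M - k) * h)"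
    using assms by (intro cong_X_mult E) auto
  also have "\<dots> = ?q M * h"
    using qbinom_qpoch[OF assms(2), of "fps_X ^ a :: 'a fps"] by simp
  also have "cong_X (Suc m) \<dots> (euler a * h)"
    using assms by (intro cong_X_mult cong_X_sym[OF E]) auto
  finally show ?thesis using h by (simp add: mult.assoc)
qed

text \<open>The limit of the finite identity with N factors of each kind. After multiplication by
  \<open>euler a\<close> the Gaussian binomials tend to 1; the agreement is worse far from the
  centre, where the powers of q compensate.\<close>

lemma jacobi_triple:
  fixes \<zeta> :: "int \<Rightarrow> 'a::comm_ring_1"
  assumes "1 \<le> a" "g \<le> a" and \<zeta>0: "\<zeta> 0 = 1" and \<zeta>: "\<And>s t. \<zeta> (s + t) = \<zeta> s * \<zeta> t"
  shows "jacobi a g \<zeta> * euler a = theta (int a) (int g) \<zeta>"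
proof (rule cong_X_all_imp_eq)
  fix N
  define w where "w s = int a * tri s - int g * s" for s
  define t where "t s = fps_const (\<zeta> s) * fps_X ^ nat (w s)" for s
  define q where "q = (fps_X ^ a :: 'a fps)"
  have w0: "w s \<ge> 0" and w1: "\<bar>s\<bar> - 1 \<le> w s" for s
    using abs_le_tri_weight[of "int a" "int g" s] assms by (auto simp: w_def)
  have t0: "t 0 = 1" by (simp add: t_def \<zeta>0 w_def)
  have up: "fps_const (\<zeta> 1) * fps_X ^ (a - g) * q ^ n * t s = q ^ nat (int n - s) * t (s + 1)"
    if "s \<le> int n" for s n
  proof -
    have "int (a - g + a * n + nat (w s)) = int (a * nat (int n - s) + nat (w (s + 1)))"
      using w0[of s] w0[of "s + 1"] that assms(2)
      by (simp add: of_nat_diff w_def tri_add1' algebra_simps)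
    then have "a - g + a * n + nat (w s) = a * nat (int n - s) + nat (w (s + 1))"
      by (simp only: of_nat_eq_iff)
    then have e: "fps_X ^ (a - g) * q ^ n * fps_X ^ nat (w s) =
        q ^ nat (int n - s) * fps_X ^ nat (w (s + 1))"
      by (simp add: q_def flip: power_mult power_add)
    have "fps_const (\<zeta> 1) * fps_X ^ (a - g) * q ^ n * t s =
        fps_const (\<zeta> 1 * \<zeta> s) * (fps_X ^ (a - g) * q ^ n * fps_X ^ nat (w s))"
      by (simp add: t_def algebra_simps flip: fps_const_mult)
    also have "\<zeta> 1 * \<zeta> s = \<zeta> (s + 1)" using \<zeta>[of s 1] by (simp add: mult.commute)
    finally show ?thesis unfolding e t_def by (simp add: algebra_simps)
  qed
  have down: "fps_const (\<zeta> (-1)) * fps_X ^ g * q ^ n * t s = q ^ nat (int n + s) * t (s - 1)"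
    if "- s \<le> int n" for s n
  proof -
    have "int (g + a * n + nat (w s)) = int (a * nat (int n + s) + nat (w (s - 1)))"
      using w0[of s] w0[of "s - 1"] that
      by (simp add: w_def tri_diff1 algebra_simps)
    then have "g + a * n + nat (w s) = a * nat (int n + s) + nat (w (s - 1))"
      by (simp only: of_nat_eq_iff)
    then have e: "fps_X ^ g * q ^ n * fps_X ^ nat (w s) = q ^ nat (int n + s) * fps_X ^ nat (w (s - 1))"
      by (simp add: q_def flip: power_mult power_add)
    have "fps_const (\<zeta> (-1)) * fps_X ^ g * q ^ n * t s =
        fps_const (\<zeta> (-1) * \<zeta> s) * (fps_X ^ g * q ^ n * fps_X ^ nat (w s))"
      by (simp add: t_def algebra_simps flip: fps_const_mult)
    also have "\<zeta> (-1) * \<zeta> s = \<zeta> (s - 1)" using \<zeta>[of s "-1"] by (simp add: mult.commute)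
    finally show ?thesis unfolding e t_def by (simp add: algebra_simps)
  qed
  have fin: "(\<Prod>n<N. 1 + fps_const (\<zeta> 1) * fps_X ^ (a - g) * q ^ n) *
      (\<Prod>n<N. 1 + fps_const (\<zeta> (-1)) * fps_X ^ g * q ^ n) =
      (\<Sum>k\<le>N + N. qbinom q (N + N) k * t (int k - int N))"
    by (rule finite_jacobi_triple[where t = t, OF t0 up down])
  have "cong_X N (jacobi a g \<zeta> * euler a)
     ((\<Prod>k<N. (1 + fps_const (\<zeta> 1) * fps_X ^ (a * k + (a - g))) *
      (1 + fps_const (\<zeta> (-1)) * fps_X ^ (a * k + g))) * euler a)"
    unfolding jacobi_def using assms(1) by (intro cong_X_mult iprod_cong_X tame_jacobi) auto
  also have "(\<Prod>k<N. (1 + fps_const (\<zeta> 1) * fps_X ^ (a * k + (a - g))) *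
      (1 + fps_const (\<zeta> (-1)) * fps_X ^ (a * k + g))) =
      (\<Sum>k\<le>N + N. qbinom q (N + N) k * t (int k - int N))"
    unfolding fin[symmetric]
    by (simp add: prod.distrib q_def power_add mult_ac flip: power_mult)
  also have "\<dots> * euler a = (\<Sum>k\<le>N + N. qbinom q (N + N) k * euler a * t (int k - int N))"
    unfolding sum_distrib_right by (simp add: mult_ac)
  also have "cong_X N \<dots> (\<Sum>k\<le>N + N. t (int k - int N))"
  proof (intro cong_X_sum)
    fix k assume "k \<in> {..N + N}"
    then have k: "k \<le> N + N" by simp
    define m where "m = min k (N + N - k)"
    define s where "s = int k - int N"
    have m: "int m = int N - \<bar>s\<bar>" using k by (auto simp: m_def s_def)
    \<comment> \<open>The binomial contributes the order N - |s| + 1, and \<open>w s\<close> is at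
      least |s| - 1: together at least N.\<close>
    have "cong_X (Suc m + nat (w s)) (qbinom q (N
        + N) k * euler a * fps_X ^ nat (w s)) (1 * fps_X ^ nat (w s))"
      unfolding q_def using k assms(1) by (intro cong_X_mult_X_power qbinom_euler) (auto simp: m_def)
    then have "cong_X N (qbinom q (N + N) k * euler a * fps_X ^ nat (w s)) (1 * fps_X ^ nat (w s))"
      by (rule cong_X_mono) (use m w1[of s] in linarith)
    then have "cong_X N (fps_const (\<zeta> s) * (qbinom q (N + N) k * euler a * fps_X ^ nat (w s)))
        (fps_const (\<zeta> s) * (1 * fps_X ^ nat (w s)))"
      by (rule cong_X_mult[OF cong_X_refl])
    then show "cong_X N (qbinom q (N + N) k * euler a * t (int k - int N)) (t (int k - int N))"
      by (simp add: t_def s_def mult_ac)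
  qed
  also have "(\<Sum>k\<le>N + N. t (int k - int N)) = (\<Sum>s=-int N..int N. t s)"
    by (rule sum.reindex_bij_witness[where i = "\<lambda>s. nat (s + int N)" and j = "\<lambda>k. int k - int N"]) auto
  also have "cong_X N \<dots> (theta (int a) (int g) \<zeta>)"
    unfolding cong_X_def
  proof (intro allI impI)
    fix n assume n: "n < N"
    have "(\<Sum>s=-int N..int N. t s) $ n = (\<Sum>s=-int N..int N. if w s = int n then \<zeta> s else 0)"
      unfolding fps_sum_nth t_def using w0 by (intro sum.cong) (auto simp: fps_X_power_nth)
    also have "\<dots> = (\<Sum>s | s \<in> {-int N..int N} \<and> w s = int n. \<zeta> s)"
      by (rule sum.inter_filter[symmetric]) simp
    also have "{s. s \<in> {-int N..int N} \<and> w s = int n} = {s. s \<in> UNIV \<and> w s = int n}"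
    proof safe
      fix s assume "w s = int n"
      with w1[of s] n show "s \<in> {-int N..int N}" by auto
    qed auto
    finally show "(\<Sum>s=-int N..int N. t s) $ n = theta (int a) (int g) \<zeta> $ n"
      by (simp add: theta_def gen_nth w_def)
  qed
  finally show "cong_X N (jacobi a g \<zeta> * euler a) (theta (int a) (int g) \<zeta>)" .
qed

section \<open>Laurent coefficients and colored Frobenius symbols\<close>

text \<open>Used above all for three maps: constants into Laurent polynomials, integers into complex
  numbers, and the substitution of q^3 for q.\<close>

definition ring_map :: "('a::comm_ring_1 \<Rightarrow> 'b::comm_ring_1) \<Rightarrow> bool" where
  "ring_map h \<longleftrightarrow> h 1 = 1 \<and> (\<forall>x y. h (x + y) = h x + h y) \<and> (\<forall>x y. h (x * y) = h x * h y)"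

definition fps_map :: "('a \<Rightarrow> 'b) \<Rightarrow> 'a fps \<Rightarrow> 'b fps" where
  "fps_map h f = Abs_fps (\<lambda>n. h (f $ n))"

lemma fps_map_nth [simp]: "fps_map h f $ n = h (f $ n)"
  by (simp add: fps_map_def)

lemma ring_map_simps:
  assumes "ring_map h"
  shows "h 1 = 1" "h 0 = 0" "h (x + y) = h x + h y" "h (x * y) = h x * h y"
    "h (x - y) = h x - h y" "h (sum f A) = (\<Sum>i\<in>A. h (f i))"
proof -
  show h: "h 1 = 1" "h (x + y) = h x + h y" "h (x * y) = h x * h y" for x y
    using assms by (auto simp: ring_map_def)
  show h0: "h 0 = 0" using h(2)[of 0 0] by simp
  show "h (x - y) = h x - h y" using h(2)[of "x - y" y] by simp
  show "h (sum f A) = (\<Sum>i\<in>A. h (f i))"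
    by (induction A rule: infinite_finite_induct) (auto simp: h0 h)
qed

lemma ring_map_fps_map:
  assumes "ring_map h"
  shows "ring_map (fps_map h)"
  unfolding ring_map_def
  by (auto simp: fps_eq_iff fps_mult_nth fps_one_nth ring_map_simps[OF assms] ring_map_def)

lemma ring_map_prod:
  assumes "ring_map h"
  shows "h (prod f A) = (\<Prod>i\<in>A. h (f i))"
  by (induction A rule: infinite_finite_induct) (auto simp: ring_map_simps[OF assms])

lemma ring_map_power:
  assumes "ring_map h"
  shows "h (x ^ n) = h x ^ n"
  by (induction n) (auto simp: ring_map_simps[OF assms])

lemma fps_map_euler:
  assumes "ring_map h"
  shows "fps_map h (euler m) = euler m"
proof (rule fps_ext)
  fix n
  note H = ring_map_fps_map[OF assms]
  have X: "fps_map h fps_X = fps_X"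
    by (simp add: fps_eq_iff fps_X_def ring_map_simps[OF assms])
  have "fps_map h (\<Prod>k\<le>n. 1 - fps_X ^ (m * (k + 1))) = (\<Prod>k\<le>n. 1 - fps_X ^ (m * (k + 1)))"
    by (simp add: ring_map_prod[OF H] ring_map_simps[OF H] ring_map_power[OF H] X)
  then show "fps_map h (euler m) $ n = euler m $ n"
    unfolding fps_eq_iff by (simp add: euler_def iprod_def)
qed

lemma fps_map_gen:
  assumes "ring_map h"
  shows "fps_map h (gen S w \<chi>) = gen S w (\<lambda>s. h (\<chi> s))"
  by (rule fps_ext) (simp add: gen_nth ring_map_simps[OF assms])

lemma ring_map_single: "ring_map (Poly_Mapping.single (0::int))"
  by (simp add: ring_map_def single_add mult_single)

abbreviation lift :: "'a::comm_ring_1 fps \<Rightarrow> (int \<Rightarrow>\<^sub>0 'a) fps" where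
  "lift \<equiv> fps_map (Poly_Mapping.single 0)"

definition ct :: "(int \<Rightarrow>\<^sub>0 'a::comm_ring_1) fps \<Rightarrow> 'a fps" where
  "ct f = Abs_fps (\<lambda>n. Poly_Mapping.lookup (f $ n) 0)"

lemma ct_nth [simp]: "ct f $ n = Poly_Mapping.lookup (f $ n) 0"
  by (simp add: ct_def)

lemma ct_add: "ct (f + g) = ct f + ct g"
  by (simp add: fps_eq_iff lookup_add)

lemma lookup_single_0_mult: "Poly_Mapping.lookup (Poly_Mapping.single (0::int) c * p) k =
    c * Poly_Mapping.lookup p k"
  by (simp add: lookup_mult lookup_single when_mult)

lemma ct_lift_mult: "ct (lift f * g) = f * ct g"
  by (simp add: fps_eq_iff fps_mult_nth lookup_sum lookup_single_0_mult)

lemma ct_gen: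
  assumes "graded S w"
  shows "ct (gen S w (\<lambda>s. Poly_Mapping.single (d s) (\<chi> s))) = gen {s \<in> S. d s = 0} w \<chi>"
proof (rule fps_ext)
  fix n
  have "ct (gen S w (\<lambda>s. Poly_Mapping.single (d s) (\<chi> s))) $ n =
      (\<Sum>s | s \<in> S \<and> w s = int n. if d s = 0 then \<chi> s else 0)"
    by (auto simp: gen_nth lookup_sum lookup_single when_def intro!: sum.cong)
  also have "\<dots> = (\<Sum>s | s \<in> {s. s \<in> S \<and> w s = int n} \<and> d s = 0. \<chi> s)"
    using assms by (intro sum.inter_filter[symmetric]) (simp add: graded_def)
  finally show "ct (gen S w (\<lambda>s. Poly_Mapping.single (d s) (\<chi> s))) $ n = gen {s \<in> S. d s = 0} w \<chi> $ n"
    by (simp add: gen_nth conj_ac)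
qed

text \<open>The monomial \<open>z\<^sup>s\<close>; a Laurent polynomial in \<open>z\<close> is a finitely supported map on the integers,
  and \<open>ct\<close> extracts the coefficient of \<open>z\<^sup>0\<close>.\<close>

definition zpow :: "int \<Rightarrow> int \<Rightarrow>\<^sub>0 'a::comm_ring_1" where
  "zpow s = Poly_Mapping.single s 1"

lemma lookup_zpow: "Poly_Mapping.lookup (zpow s) t = (if s = t then 1 else 0)"
  by (simp add: zpow_def lookup_single when_def)

section \<open>Frobenius symbols as pairs of finite sets\<close>

lemma gf_row_iff:
  "gf_row k xs \<longleftrightarrow> set xs \<subseteq> UNIV \<times> {1..k} \<and> sorted_wrt (<) (rev xs)"
proof -
  have "cless x y \<longleftrightarrow> x < y" for x y
    by (cases x; cases y) (auto simp: less_prod_def')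
  then show ?thesis by (auto simp: gf_row_def sorted_wrt_rev)
qed

lemma gf_row_eqI:
  assumes "gf_row k xs" "gf_row k ys" "set xs = set ys"
  shows "xs = ys"
proof -
  have "rev ys = rev xs"
    using assms by (intro strict_sorted_equal) (auto simp: gf_row_iff)
  then show ?thesis by simp
qed

lemma gf_row_distinct: "gf_row k xs \<Longrightarrow> distinct xs"
  by (metis gf_row_iff distinct_rev strict_sorted_iff)

lemma gf_row_length: "gf_row k xs \<Longrightarrow> length xs = card (set xs)"
  by (simp add: gf_row_distinct distinct_card)

lemma gf_row_sum: "gf_row k xs \<Longrightarrow> (\<Sum>(l, c)\<leftarrow>xs. l) = sum fst (set xs)"
  by (simp add: gf_row_distinct sum_list_distinct_conv_sum_set case_prod_unfold)

lemma gf_row_exists: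
  assumes "finite A" "A \<subseteq> UNIV \<times> {1..k}"
  shows "\<exists>xs. gf_row k xs \<and> set xs = A"
  using assms by (intro exI[of _ "rev (sorted_list_of_set A)"]) (auto simp: gf_row_iff)

text \<open>A strictly decreasing row is determined by its set of entries. The number of columns is
  absorbed by adding 1 to each entry of the first row. Every entry is at most n, so any
  \<open>N\<close> above n bounds them all.\<close>

lemma cphi_eq_card:
  assumes "n < N"
  shows "cphi k n = card {(A, B). A \<subseteq> {..<N} \<times> {1..k} \<and> B \<subseteq> {..<N} \<times> {1..k} \<and>
    card A = card B \<and> (\<Sum>x\<in>A. fst x + 1) + (\<Sum>x\<in>B. fst x) = n}" (is "_ = card ?S")
  unfolding cphi_def
proof (rule bij_betw_same_card)
  let ?f = "\<lambda>(as, bs). (set as, set bs) :: cnat set \<times> cnat set"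
  show "bij_betw ?f (gf_partitions k n) ?S"
    unfolding bij_betw_def
  proof
    show "inj_on ?f (gf_partitions k n)"
      by (auto simp: inj_on_def gf_partitions_def gf_symbols_def intro: gf_row_eqI)
    have size: "gf_size (as, bs) = (\<Sum>x\<in>set as. fst x + 1) + (\<Sum>x\<in>set bs. fst x)"
      if "gf_row k as" "gf_row k bs" for as bs
      using that gf_row_length[of k as] gf_row_sum[of k as] gf_row_sum[of k bs]
      by (simp add: sum.distrib sum_Suc)
    show "?f ` gf_partitions k n = ?S"
    proof (intro equalityI subsetI)
      fix P assume "P \<in> ?f ` gf_partitions k n"
      then obtain as bs where P: "P = (set as, set bs)" and r: "gf_row k as" "gf_row k bs"
        and l: "length as = length bs" and s: "gf_size (as, bs) = n"
        by (auto simp: gf_partitions_def gf_symbols_def)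
      have "fst x < N" if "x \<in> set as \<union> set bs" for x
      proof -
        have "fst x \<le> (\<Sum>x\<in>set as. fst x + 1) + (\<Sum>x\<in>set bs. fst x)"
          using that member_le_sum[of x "set as" "\<lambda>x. fst x + 1"] member_le_sum[of x "set bs" fst]
          by fastforce
        then show ?thesis using s size[OF r] assms by simp
      qed
      with r l s size[OF r] show "P \<in> ?S"
        by (fastforce simp: P gf_row_iff gf_row_length[OF r(1)] gf_row_length[OF r(2)] simp del:
            gf_size.simps)
    next
      fix P assume "P \<in> ?S"
      then obtain A B where P: "P = (A, B)" and A: "A \<subseteq> {..<N} \<times> {1..k}" and B: "B \<subseteq> {..<N} \<times> {1..k}"
        and c: "card A = card B" "(\<Sum>x\<in>A. fst x + 1) + (\<Sum>x\<in>B. fst x) = n" by blast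
      have "finite A" "finite B" using A B finite_subset by blast+
      then obtain as bs where r: "gf_row k as" "set as = A" "gf_row k bs" "set bs = B"
        using gf_row_exists[of A k] gf_row_exists[of B k] A B by blast
      then have "(as, bs) \<in> gf_partitions k n"
        using c size[of as bs] gf_row_length[of k as] gf_row_length[of k bs]
        by (simp add: gf_partitions_def gf_symbols_def del: gf_size.simps)
      then show "P \<in> ?f ` gf_partitions k n"
        using r P by force
    qed
  qed
qed

text \<open>A subset records from which of the N m binomials the nonconstant term is taken; the m
  copies of each factor provide the colors.\<close>

lemma prod_power_expand:
  fixes c :: "'a::comm_ring_1" and N m :: nat
  shows "(\<Prod>k<N. (1 + fps_const c * fps_X ^ e k) ^ m) =
    (\<Sum>A\<in>Pow ({..<N} \<times> {1..m}). fps_const (c ^ card A) * fps_X ^ (\<Sum>x\<in>A. e (fst x)))"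
proof -
  let ?I = "{..<N} \<times> {1..m}"
  have "(\<Prod>k<N. (1 + fps_const c * fps_X ^ e k) ^ m) =
      (\<Prod>x\<in>?I. fps_const c * fps_X ^ e (fst x) + 1)"
  proof -
    have "(\<Prod>k<N. (1 + fps_const c * fps_X ^ e k) ^ m) =
        (\<Prod>k<N. \<Prod>j\<in>{1..m}. fps_const c * fps_X ^ e k + 1)"
      by (simp add: add.commute)
    also have "\<dots> = (\<Prod>(k, j)\<in>?I. fps_const c * fps_X ^ e k + 1)"
      by (rule prod.cartesian_product)
    finally show ?thesis by (simp only: case_prod_unfold)
  qed
  also have "\<dots> = (\<Sum>A\<in>Pow ?I. (\<Prod>x\<in>A. fps_const c * fps_X ^ e (fst x)) * (\<Prod>x\<in>?I - A. 1))"
    by (rule prod_add) simp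
  also have "\<dots> = (\<Sum>A\<in>Pow ?I. fps_const (c ^ card A) * fps_X ^ (\<Sum>x\<in>A. e (fst x)))"
    by (simp add: prod.distrib power_sum fps_const_power)
  finally show ?thesis .
qed

lemma zpow_power: "zpow s ^ n = zpow (s * int n)"
  by (induction n) (simp_all add: zpow_def mult_single algebra_simps)

lemma zpow_mult: "zpow s * zpow t = zpow (s + t)"
  by (simp add: zpow_def mult_single)

text \<open>A term z q^(k+1) contributes an entry k to the first row, a term q^k / z an entry k to
  the second. The constant term in z selects rows of equal length.\<close>

lemma cphi_generating_function:
  "ct (jacobi 1 0 zpow ^ m) = Abs_fps (\<lambda>n. of_nat (cphi m n) :: 'a::comm_ring_1)"
proof (rule fps_ext)
  fix n
  define N where "N = Suc n"
  define I where "I = {..<N} \<times> {1..m}"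
  define wt where "wt = (\<lambda>(A::cnat set, B::cnat set). (\<Sum>x\<in>A. fst x + 1) + (\<Sum>x\<in>B. fst x))"
  define p :: "nat \<Rightarrow> (int \<Rightarrow>\<^sub>0 'a) fps" where "p =
      (\<lambda>k. (1 + fps_const (zpow 1) * fps_X ^ (1 * k + (1 - 0))) *
      (1 + fps_const (zpow (-1)) * fps_X ^ (1 * k + 0)))"
  have tame: "tame p" unfolding p_def by (rule tame_jacobi) simp
  have "cong_X N (jacobi 1 0 zpow ^ m) (\<Prod>k<N. p k ^ m)"
    unfolding jacobi_def p_def[symmetric] iprod_power[OF tame, symmetric]
    by (intro iprod_cong_X tame_power tame)
  then have "(jacobi 1 0 zpow ^ m) $ n = (\<Prod>k<N. p k ^ m) $ n"
    by (simp add: cong_X_def N_def)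
  also have "(\<Prod>k<N. p k ^ m) = (\<Prod>k<N. (1 + fps_const (zpow 1) * fps_X ^ (k + 1)) ^ m) *
      (\<Prod>k<N. (1 + fps_const (zpow (-1)) * fps_X ^ k) ^ m)"
    by (simp add: p_def power_mult_distrib prod.distrib)
  also have "\<dots> = (\<Sum>(A, B)\<in>Pow I \<times> Pow I. fps_const (zpow (int (card A) - int (card B))) * fps_X ^ wt
      (A, B))"
    unfolding prod_power_expand I_def[symmetric]
    unfolding sum_product sum.cartesian_product
    by (intro sum.cong refl)
       (auto simp: zpow_power wt_def power_add mult_ac zpow_mult[symmetric]
         diff_conv_add_uminus simp flip: fps_const_mult simp del: add_uminus_conv_diff)
  also have "\<dots> $ n = (\<Sum>P\<in>Pow I \<times> Pow I. if wt P =
      n then zpow (int (card (fst P)) - int (card (snd P))) else 0)"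
    by (auto simp: fps_sum_nth fps_X_power_nth intro!: sum.cong)
  finally have J: "(jacobi 1 0 zpow ^ m) $ n = \<dots>" .
  have "ct (jacobi 1 0 zpow ^ m) $ n =
      (\<Sum>P\<in>Pow I \<times> Pow I. if wt P = n \<and> card (fst P) = card (snd P) then 1 else (0::'a))"
    unfolding ct_nth J by (auto simp: lookup_sum lookup_zpow intro!: sum.cong)
  also have "\<dots> = of_nat (card {P \<in> Pow I \<times> Pow I. wt P = n \<and> card (fst P) = card (snd P)})"
    by (subst sum.inter_filter[symmetric]) (auto simp: I_def)
  also have "{P \<in> Pow I \<times> Pow I. wt P = n \<and> card (fst P) = card (snd P)} =
      {(A, B). A \<subseteq> {..<N} \<times> {1..m} \<and> B \<subseteq> {..<N} \<times> {1..m} \<and>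
        card A = card B \<and> (\<Sum>x\<in>A. fst x + 1) + (\<Sum>x\<in>B. fst x) = n}"
    by (auto simp: I_def wt_def)
  also have "card \<dots> = cphi m n"
    by (rule cphi_eq_card[symmetric]) (simp add: N_def)
  finally show "ct (jacobi 1 0 zpow ^ m) $ n = Abs_fps (\<lambda>n. of_nat (cphi m n) :: 'a) $ n"
    by simp
qed

section \<open>The theta series of the root lattice of type A8\<close>

lemma tri_1 [simp]: "tri 1 = 1" and tri_m1 [simp]: "tri (- 1) = 0"
  by (simp_all add: tri_def)

lemma tri_add: "tri (s + t) = tri s + tri t + s * t"
  using two_tri[of s] two_tri[of t] two_tri[of "s + t"] by (simp add: algebra_simps)

lemma tri_minus: "tri (- s) = tri s - s"
  using two_tri[of s] two_tri[of "- s"] by (simp add: algebra_simps)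

lemma tri_diff: "tri (s - t) = tri s + tri t - t - s * t"
  using tri_add[of s "- t"] by (simp add: tri_minus)

text \<open>\<open>plane 0\<close> is the root lattice A2, on which \<open>tri3\<close> is half the
  sum of the squares; \<open>plane (-1)\<close> is a translate of it.\<close>

definition plane :: "int \<Rightarrow> (int \<times> int \<times> int) set" where
  "plane r = {(i, j, k). i + j + k = r}"

lemma plane_alt: "plane r = {(i, j, k). k = r - i - j}"
  by (auto simp: plane_def)

definition tri3 :: "int \<times> int \<times> int \<Rightarrow> int" where
  "tri3 = (\<lambda>(i, j, k). tri i + tri j + tri k)"

text \<open>In Borwein's notation \<open>cub_a = a(q)\<close>, \<open>cub_a3 = a(q\<^sup>3)\<close>, \<open>q cub_c\<^sup>3 = c(q)\<^sup>3\<close> and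
  \<open>q cub_c3 = c(q\<^sup>3)\<close>; the weights \<open>tri\<close> keep all exponents integral.\<close>

definition cub_a :: "'a::comm_ring_1 fps" where
  "cub_a = gen (plane 0) tri3 (\<lambda>_. 1)"

definition cub_a3 :: "'a::comm_ring_1 fps" where
  "cub_a3 = gen (plane 0) (\<lambda>p. 3 * tri3 p) (\<lambda>_. 1)"

definition cub_c :: "'a::comm_ring_1 fps" where
  "cub_c = gen (plane (-1)) tri3 (\<lambda>_. 1)"

definition cub_c3 :: "'a::comm_ring_1 fps" where
  "cub_c3 = gen (plane (-1)) (\<lambda>p. 3 * tri3 p) (\<lambda>_. 1)"

text \<open>A lattice sum for E_3^3 / E_1. Its three coordinates belong to the offsets 2, 1, 0 that
  arise when the factors of F(z) are sorted by their index modulo 3.\<close>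

definition cub_w :: "'a::comm_ring_1 fps" where
  "cub_w = gen (plane 0) (\<lambda>(i, j, k). (3 * tri i - 2 * i) + (3 * tri j - 1 * j)
      + (3 * tri k - 0 * k)) (\<lambda>_. 1)"

text \<open>The direction (1,1,1) in a splitting of the cubic lattice: \<open>i\<close> is the
  multiple, and z records the coordinate sum \<open>3 * i - g\<close>.\<close>

definition theta3 :: "int \<Rightarrow> (int \<Rightarrow>\<^sub>0 'a::comm_ring_1) fps" where
  "theta3 g = gen UNIV (\<lambda>i. 3 * tri i - g * i) (\<lambda>i. zpow (3 * i - g))"

lemma graded_tri1: "graded UNIV tri"
  using graded_tri[of 1 0] by simp

lemma graded_tri3: "graded S tri3"
  using graded_subset[OF graded_Times3[OF graded_tri1 graded_tri1 graded_tri1], of S]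
  by (simp add: tri3_def)

lemma tri_nonneg: "0 \<le> tri s"
  using graded_tri1 by (simp add: graded_def)

lemma tri3_nonneg: "0 \<le> tri3 p"
  by (cases p) (simp add: tri3_def tri_nonneg)

lemma lift_gen: "lift (gen S w (\<lambda>_. 1)) = gen S w (\<lambda>_. 1)"
  using fps_map_gen[OF ring_map_single, of S w "\<lambda>_. 1"] by simp

text \<open>Triples are sorted by their coordinate sum modulo 3. Along t(1,1,1) the cross term in
  \<open>tri_add\<close> is t times the sum of the plane coordinates, which is constant on each
  plane; so the weights separate.\<close>

lemma theta_cube:
  "theta 1 0 zpow ^ 3 = lift cub_a * theta3 0 + lift cub_c * (theta3 1 + theta3 2)"
proof -
  let ?U = "UNIV :: (int \<times> int \<times> int) set"
  let ?S = "\<lambda>r::int. {(i, j, k). (i + j + k) mod 3 = r}"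
  let ?\<chi> = "\<lambda>(i, j, k). zpow (i + j + k) :: int \<Rightarrow>\<^sub>0 'a"
  have g: "graded UNIV (\<lambda>i. 3 * tri i - 0 * i)" "graded UNIV (\<lambda>i. 3 * tri i - 1 * i)"
    "graded UNIV (\<lambda>i. 3 * tri i - 2 * i)"
    by (rule graded_tri; simp)+
  have "theta 1 0 zpow ^ 3 = gen ?U tri3 ?\<chi>"
    using gen_Times3[OF graded_tri1 graded_tri1 graded_tri1, of zpow zpow "zpow :: int \<Rightarrow> int \<Rightarrow>\<^sub>0 'a"]
    by (simp add: theta_def power3_eq_cube tri3_def zpow_mult)
  also have "?U = ?S 0 \<union> ?S 1 \<union> ?S 2"
  proof -
    have "(i + j + k) mod 3 = 0 \<or> (i + j + k) mod 3 = 1 \<or> (i + j + k) mod 3 = 2" for i j k :: int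
      by presburger
    then show ?thesis by auto
  qed
  also have "gen \<dots> tri3 ?\<chi> = gen (?S 0) tri3 ?\<chi> + gen (?S 1) tri3 ?\<chi> + gen (?S 2) tri3 ?\<chi>"
  proof -
    have "gen (?S 0 \<union> ?S 1 \<union> ?S 2) tri3 ?\<chi> = gen (?S 0 \<union> ?S 1) tri3 ?\<chi> + gen (?S 2) tri3 ?\<chi>"
      by (rule gen_Un) (auto intro: graded_tri3)
    also have "gen (?S 0 \<union> ?S 1) tri3 ?\<chi> = gen (?S 0) tri3 ?\<chi> + gen (?S 1) tri3 ?\<chi>"
      by (rule gen_Un) (auto intro: graded_tri3)
    finally show ?thesis .
  qed
  also have "gen (?S 0) tri3 ?\<chi> = lift cub_a * theta3 0"
  proof -
    have "gen (plane 0 \<times> UNIV) (\<lambda>(u, i). tri3 u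
        + (3 * tri i - 0 * i)) (\<lambda>(u, i). 1 * zpow (3 * i - 0)) = gen (?S 0) tri3 ?\<chi>"
      by (rule gen_reindex[where f = "\<lambda>((i, j, k), t). (i + t, j + t, k + t)"
            and g = "\<lambda>(i, j, k). let t = (i + j + k) div 3 in ((i - t, j - t, k - t), t)"])
         (auto simp: plane_alt Let_def tri3_def tri_add tri_diff; simp add: algebra_simps; presburger)+
    then show ?thesis unfolding cub_a_def lift_gen theta3_def
      using gen_Times[OF graded_tri3[of "plane 0"] g(1), of "\<lambda>_. 1" "\<lambda>i. zpow (3 * i - 0) :: int \<Rightarrow>\<^sub>0 'a"]
      by simp
  qed
  \<comment> \<open>A sum of 1 modulo 3 would lead to \<open>plane 1\<close>. The symmetry
    \<open>tri (- 1 - s) = tri s\<close>, up to a shift along (1,1,1), leads back to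
    \<open>plane (-1)\<close> and thus to \<open>cub_c\<close>.\<close>
  also have "gen (?S 1) tri3 ?\<chi> = lift cub_c * theta3 2"
  proof -
    have "gen (plane (-1) \<times> UNIV) (\<lambda>(u, i). tri3 u
        + (3 * tri i - 2 * i)) (\<lambda>(u, i). 1 * zpow (3 * i - 2)) = gen (?S 1) tri3 ?\<chi>"
      by (rule gen_reindex[where f = "\<lambda>((i, j, k), t). (t - 1 - i, t - 1 - j, t - 1 - k)"
            and g = "\<lambda>(i, j, k). let t =
            (i + j + k + 2) div 3 in ((t - 1 - i, t - 1 - j, t - 1 - k), t)"])
         (auto simp: plane_alt Let_def tri3_def tri_add tri_diff; simp add: algebra_simps; presburger)+
    then show ?thesis unfolding cub_c_def lift_gen theta3_def
      using gen_Times[OF graded_tri3[of "plane (-1)"] g(3), of "\<lambda>_. 1" "\<lambda>i. zpow (3 * i - 2) :: int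
          \<Rightarrow>\<^sub>0 'a"]
      by simp
  qed
  also have "gen (?S 2) tri3 ?\<chi> = lift cub_c * theta3 1"
  proof -
    have "gen (plane (-1) \<times> UNIV) (\<lambda>(u, i). tri3 u
        + (3 * tri i - 1 * i)) (\<lambda>(u, i). 1 * zpow (3 * i - 1)) = gen (?S 2) tri3 ?\<chi>"
      by (rule gen_reindex[where f = "\<lambda>((i, j, k), t). (i + t, j + t, k + t)"
            and g = "\<lambda>(i, j, k). let t = (i + j + k + 1) div 3 in ((i - t, j - t, k - t), t)"])
         (auto simp: plane_alt Let_def tri3_def tri_add tri_diff; simp add: algebra_simps; presburger)+
    then show ?thesis unfolding cub_c_def lift_gen theta3_def
      using gen_Times[OF graded_tri3[of "plane (-1)"] g(2), of "\<lambda>_. 1" "\<lambda>i. zpow (3 * i - 1) :: int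
          \<Rightarrow>\<^sub>0 'a"]
      by simp
  qed
  finally show ?thesis by (simp add: algebra_simps)
qed

lemma ct_theta3:
  assumes "g \<in> {0, 1, 2}" "h \<in> {0, 1, 2}" "l \<in> {0, 1, 2}"
  shows "ct (theta3 g * theta3 h * theta3 l) =
    gen {(i, j, k). 3 * (i + j + k) = g + h + l}
      (\<lambda>(i, j, k). (3 * tri i - g * i) + (3 * tri j - h * j)
          + (3 * tri k - l * k)) (\<lambda>_. 1 :: 'a::comm_ring_1)"
proof -
  have g: "graded UNIV (\<lambda>i. 3 * tri i - g * i)" if "g \<in> {0, 1, 2}" for g
    using that by (intro graded_tri) auto
  note G = g[OF assms(1)] g[OF assms(2)] g[OF assms(3)]
  have "theta3 g * theta3 h * theta3 l =
      gen UNIV (\<lambda>(i, j, k). (3 * tri i - g * i) + (3 * tri j - h * j) + (3 * tri k - l * k))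
       (\<lambda>p. Poly_Mapping.single (case p of (i, j, k) \<Rightarrow> 3 * (i + j + k) - (g + h + l)) (1 :: 'a))"
    unfolding theta3_def gen_Times3[OF G]
    by (intro gen_cong) (auto simp: zpow_def mult_single algebra_simps)
  then have "ct (theta3 g * theta3 h * theta3 l) =
      gen {p \<in> UNIV \<times> UNIV \<times> UNIV. (case p of (i, j, k) \<Rightarrow> 3 * (i + j + k) - (g + h + l)) = 0}
        (\<lambda>(i, j, k). (3 * tri i - g * i) + (3 * tri j - h * j) + (3 * tri k - l * k)) (\<lambda>_. 1 :: 'a)"
    using ct_gen[OF graded_Times3[OF G], of "\<lambda>p. case p of (i, j, k) \<Rightarrow> 3 * (i + j + k) - (g + h
        + l)" "\<lambda>_. 1 :: 'a"]
    by (simp only: UNIV_Times_UNIV)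
  also have "{p \<in> UNIV \<times> UNIV \<times> UNIV. (case p of (i, j, k) \<Rightarrow> 3 * (i + j + k) - (g + h + l)) = 0} =
      {(i, j, k). 3 * (i + j + k) = g + h + l}"
    by auto
  finally show ?thesis .
qed

lemma gen_empty [simp]: "gen {} w \<chi> = 0"
  by (simp add: gen_def fps_eq_iff)

text \<open>The exponent of z is a multiple of 3 minus the sum of the offsets. Hence only the
  offsets 000, 111, 222 and the orderings of 012 survive.\<close>

lemma ct_theta3_eq_0:
  assumes "g \<in> {0, 1, 2}" "h \<in> {0, 1, 2}" "l \<in> {0, 1, 2}" "\<not> 3 dvd (g + h + l)"
  shows "ct (theta3 g * theta3 h * theta3 l) = 0"
proof -
  have "3 * m \<noteq> g + h + l" for m
    using assms(4) by (metis dvd_triv_left)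
  then have "{(i, j, k). 3 * (i + j + k) = g + h + l} = {}"
    by blast
  then show ?thesis unfolding ct_theta3[OF assms(1-3)] by (simp only: gen_empty)
qed

lemma ct_theta3_000: "ct (theta3 0 * theta3 0 * theta3 0) = cub_a3"
  unfolding cub_a3_def by (subst ct_theta3) (auto simp: plane_def tri3_def algebra_simps intro!:
      gen_cong)

lemma ct_theta3_021: "ct (theta3 0 * theta3 2 * theta3 1) = fps_X * cub_w"
proof -
  have nn: "0 \<le> (case s of (i, j, k) \<Rightarrow> (3 * tri i - 2 * i) + (3 * tri j - 1 * j)
      + (3 * tri k - 0 * k))" for s
    using abs_le_tri_weight(2)[of 3 2] abs_le_tri_weight(2)[of 3 1] abs_le_tri_weight(2)[of 3 0]
    by (auto simp: case_prod_unfold intro!: add_nonneg_nonneg)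
  have "fps_X ^ 1 * cub_w = gen (plane 0) (\<lambda>s. (case s of (i, j, k) \<Rightarrow> (3 * tri i - 2 * i)
      + (3 * tri j - 1 * j) + (3 * tri k - 0 * k)) + int 1) (\<lambda>_. 1 :: 'a)"
    unfolding cub_w_def by (rule gen_shift) (rule nn)
  moreover have "ct (theta3 0 * theta3 2 * theta3 1) = \<dots>"
    \<comment> \<open>Replacing \<open>j\<close> by \<open>j - 1\<close> moves the coordinate sum
      from 1 to 0. The subtracted linear part changes its coefficients in i, j, k from (0, 2, 1) to
      (1, 3, 2), that is, it grows by i + j + k = 1, which the factor q makes up for.\<close>
    by (rule trans[OF ct_theta3 gen_reindex[where f = "\<lambda>(i, j, k). (k, i, j - 1)" and g =
        "\<lambda>(k, i, j). (i, j + 1, k)"]])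
       (auto simp: plane_def tri_diff1 algebra_simps)
  ultimately show ?thesis by simp
qed

lemma X2_cub_c3: "fps_X ^ 2 * cub_c3 = gen (plane (-1)) (\<lambda>s. 3 * tri3 s + 2) (\<lambda>_. 1)"
  using gen_shift[of "plane (-1)" "\<lambda>s. 3 * tri3 s" 2 "\<lambda>_. 1 :: 'a"] tri3_nonneg
  by (simp add: cub_c3_def)

lemma ct_theta3_111: "ct (theta3 1 * theta3 1 * theta3 1) = fps_X ^ 2 * cub_c3"
  unfolding X2_cub_c3
  by (rule trans[OF ct_theta3 gen_reindex[where f = "\<lambda>(i, j, k). (-i, -j, -k)" and g =
      "\<lambda>(i, j, k). (-i, -j, -k)"]])
     (auto simp: plane_def tri3_def tri_minus algebra_simps)

lemma ct_theta3_222: "ct (theta3 2 * theta3 2 * theta3 2) = fps_X ^ 2 * cub_c3"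
  unfolding X2_cub_c3
  by (rule trans[OF ct_theta3 gen_reindex[where f = "\<lambda>(i, j, k). (i - 1, j - 1, k - 1)" and g =
      "\<lambda>(i, j, k). (i + 1, j + 1, k + 1)"]])
     (auto simp: plane_def tri3_def tri_diff1 algebra_simps)

text \<open>Multiplicities inside the brackets are written as repeated summands, so that
  \<open>ct_add\<close> alone reaches every monomial.\<close>

lemma trinomial_cube:
  fixes A C r s t :: "'a::comm_ring_1"
  shows "(A * r + C * (s + t)) ^ 3 = A ^ 3 * (r * r * r)
     + A ^ 2 * C * (r * r * s + r * r * s + r * r * s
        + r * r * t + r * r * t + r * r * t)
     + A * C ^ 2 * (r * s * s + r * s * s + r * s * s
        + r * t * t + r * t * t + r * t * t)
     + A * C ^ 2 * (r * t * s + r * t * s + r * t * s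
        + r * t * s + r * t * s + r * t * s)
     + C ^ 3 * (s * s * s + t * t * t
        + s * s * t + s * s * t + s * s * t
        + s * t * t + s * t * t + s * t * t)"
  by (simp add: power3_eq_cube power2_eq_square algebra_simps)

text \<open>The theta series of A8 is the constant term of the cube of \<open>theta_cube\<close>.
  The 6 counts the orderings of the offsets 0, 1, 2, and the 2 comes from 111 and 222.\<close>

lemma ct_theta_power9:
  "ct (theta 1 0 zpow ^ 9) = (cub_a ^ 3 * cub_a3 + 6 * cub_a * cub_c ^ 2 * (fps_X * cub_w)
     + 2 * cub_c ^ 3 * (fps_X ^ 2 * cub_c3) :: 'a::comm_ring_1 fps)"
proof -
  let ?T = "theta3 :: int \<Rightarrow> (int \<Rightarrow>\<^sub>0 'a) fps"
  let ?L = "lift :: 'a fps \<Rightarrow> _"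
  note H = ring_map_fps_map[OF ring_map_single]
  note hom = ring_map_simps[OF H] ring_map_power[OF H]
  have "theta 1 0 zpow ^ 9 = (?L cub_a * ?T 0 + ?L cub_c * (?T 1 + ?T 2)) ^ 3"
    unfolding theta_cube[symmetric] by (simp flip: power_mult)
  also have "\<dots> = ?L cub_a ^ 3 * (?T 0 * ?T 0 * ?T 0)
     + ?L cub_a ^ 2 * ?L cub_c * (?T 0 * ?T 0 * ?T 1 + ?T 0 * ?T 0 * ?T 1 + ?T 0 * ?T 0 * ?T 1
        + ?T 0 * ?T 0 * ?T 2 + ?T 0 * ?T 0 * ?T 2 + ?T 0 * ?T 0 * ?T 2)
     + ?L cub_a * ?L cub_c ^ 2 * (?T 0 * ?T 1 * ?T 1 + ?T 0 * ?T 1 * ?T 1 + ?T 0 * ?T 1 * ?T 1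
        + ?T 0 * ?T 2 * ?T 2 + ?T 0 * ?T 2 * ?T 2 + ?T 0 * ?T 2 * ?T 2)
     + ?L cub_a * ?L cub_c ^ 2 * (?T 0 * ?T 2 * ?T 1 + ?T 0 * ?T 2 * ?T 1 + ?T 0 * ?T 2 * ?T 1
        + ?T 0 * ?T 2 * ?T 1 + ?T 0 * ?T 2 * ?T 1 + ?T 0 * ?T 2 * ?T 1)
     + ?L cub_c ^ 3 * (?T 1 * ?T 1 * ?T 1 + ?T 2 * ?T 2 * ?T 2
        + ?T 1 * ?T 1 * ?T 2 + ?T 1 * ?T 1 * ?T 2 + ?T 1 * ?T 1 * ?T 2
        + ?T 1 * ?T 2 * ?T 2 + ?T 1 * ?T 2 * ?T 2 + ?T 1 * ?T 2 * ?T 2)"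
    by (rule trinomial_cube)
  finally have expand: "theta 1 0 zpow ^ 9 = \<dots>" .
  have zero: "ct (?T 0 * ?T 0 * ?T 1) = 0" "ct (?T 0 * ?T 0 * ?T 2) = 0" "ct (?T 0 * ?T 1 * ?T 1) = 0"
    "ct (?T 0 * ?T 2 * ?T 2) = 0" "ct (?T 1 * ?T 1 * ?T 2) = 0" "ct (?T 1 * ?T 2 * ?T 2) = 0"
    by (rule ct_theta3_eq_0; simp)+
  show ?thesis
    unfolding expand hom(4)[symmetric] hom(7)[symmetric] ct_add ct_lift_mult zero
      ct_theta3_000 ct_theta3_021 ct_theta3_111 ct_theta3_222
    by (simp add: algebra_simps)
qed

section \<open>Cubic theta functions\<close>

lemma square_eq_tri: "s * s = 2 * tri s - s"
  unfolding two_tri by (simp add: algebra_simps)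

lemma tri_double: "tri (2 * s) = 4 * tri s - s"
  using tri_add[of s s] by (simp add: square_eq_tri)

lemmas tri_expand = tri_add tri_diff tri_minus tri_double tri_double[unfolded mult.commute[of 2]]
    square_eq_tri

lemma gen_mod3:
  assumes "graded S w"
  shows "gen S w (\<lambda>s. f (d s mod 3 :: int)) = fps_const (f 0) * gen {s \<in> S. d s mod 3 = 0} w (\<lambda>_. 1)
    + fps_const (f 1) * gen {s \<in> S. d s mod 3 = 1} w (\<lambda>_. 1)
    + fps_const (f 2) * gen {s \<in> S. d s mod 3 = 2} w (\<lambda>_. 1)"
proof -
  let ?S = "\<lambda>r. {s \<in> S. d s mod 3 = r}" and ?\<chi> = "\<lambda>s. f (d s mod 3)"
  have S: "S = ?S 0 \<union> ?S 1 \<union> ?S 2"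
  proof -
    have "x mod 3 = 0 \<or> x mod 3 = 1 \<or> x mod 3 = 2" for x :: int
      by presburger
    then show ?thesis by auto
  qed
  have "gen S w ?\<chi> = gen (?S 0 \<union> ?S 1 \<union> ?S 2) w ?\<chi>"
    using S by simp
  also have "\<dots> = gen (?S 0 \<union> ?S 1) w ?\<chi> + gen (?S 2) w ?\<chi>"
    by (rule gen_Un) (auto intro: graded_subset[OF assms])
  also have "gen (?S 0 \<union> ?S 1) w ?\<chi> = gen (?S 0) w ?\<chi> + gen (?S 1) w ?\<chi>"
    by (rule gen_Un) (auto intro: graded_subset[OF assms])
  finally show ?thesis
    unfolding gen_scale by (simp only: mult_1_right) (auto intro!: arg_cong2[where f = "(+)"] gen_cong)
qed

lemma X_cub_c3: "fps_X * cub_c3 = gen (plane (-1)) (\<lambda>s. 3 * tri3 s + 1) (\<lambda>_. 1)"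
  using gen_shift[of "plane (-1)" "\<lambda>s. 3 * tri3 s" 1 "\<lambda>_. 1 :: 'a"] tri3_nonneg
  by (simp add: cub_c3_def)

text \<open>The map to (i - j, j - k, k - i) acts on A2 like multiplication by a square root of -3:
  it triples the norm. It carries \<open>plane 0\<close> onto the class 0 and
  \<open>plane (-1)\<close> onto the class 2; negation exchanges the classes 1 and 2. In the
  inverse, \<open>t\<close> recovers the middle coordinate.\<close>

lemma plane_trisect:
  shows "gen {(i, j, k) \<in> plane 0. (i - j) mod 3 = 0} tri3 (\<lambda>_. 1) =
      (cub_a3 :: 'a::comm_ring_1 fps)" (is ?a)
    and "gen {(i, j, k) \<in> plane 0. (i - j) mod 3 = 1} tri3 (\<lambda>_. 1) = (fps_X * cub_c3 :: 'a fps)" (is ?b)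
    and "gen {(i, j, k) \<in> plane 0. (i - j) mod 3 = 2} tri3 (\<lambda>_. 1) = (fps_X * cub_c3 :: 'a fps)" (is ?c)
proof -
  show ?a unfolding cub_a3_def
    by (rule sym, rule gen_reindex[where f = "\<lambda>(i, j, k). (i - j, j - k, k - i)"
          and g = "\<lambda>(i, j, k). let t = (j - i) div 3 in (i + t, t, t - j)"])
       (auto simp: plane_alt Let_def tri3_def; (presburger | simp add: tri_expand algebra_simps))+
  show c: ?c unfolding X_cub_c3
    by (rule sym, rule gen_reindex[where f = "\<lambda>(i, j, k). (i - j, j - k, k - i)"
          and g = "\<lambda>(i, j, k). let t = (j - i - 1) div 3 in (i + t, t, t - j)"])
       (auto simp: plane_alt Let_def tri3_def; (presburger | simp add: tri_expand algebra_simps))+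
  have "gen {(i, j, k) \<in> plane 0. (i - j) mod 3 = 1} tri3 (\<lambda>_. 1) =
      (gen {(i, j, k) \<in> plane 0. (i - j) mod 3 = 2} tri3 (\<lambda>_. 1) :: 'a fps)"
    by (rule gen_reindex[where f = "\<lambda>(i, j, k). (-i, -j, -k)" and g = "\<lambda>(i, j, k). (-i, -j, -k)"])
       (auto simp: plane_alt tri3_def; (presburger | simp add: tri_expand algebra_simps))+
  with c show ?b by (rule trans[rotated])
qed

text \<open>A constant \<open>f\<close> gives the trisection of \<open>cub_a\<close>; powers of a
  primitive cube root of unity give the series b.\<close>

lemma gen_plane_character:
  "gen (plane 0) tri3 (\<lambda>(i, j, k). f ((i - j) mod 3)) =
    fps_const (f 0) * cub_a3 + fps_const (f 1 + f 2) * (fps_X * cub_c3)"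
proof -
  have *: "{s \<in> plane 0. (case s of (i, j, k) \<Rightarrow> i - j) mod 3 = r} =
      {(i, j, k) \<in> plane 0. (i - j) mod 3 = r}" for r
    by auto
  have "gen (plane 0) tri3 (\<lambda>(i, j, k). f ((i - j) mod 3)) =
      gen (plane 0) tri3 (\<lambda>s. f ((case s of (i, j, k) \<Rightarrow> i - j) mod 3))"
    by (simp add: case_prod_unfold)
  then show ?thesis
    unfolding gen_mod3[OF graded_tri3] * plane_trisect
    by (simp add: algebra_simps flip: fps_const_add)
qed

lemma cub_a_trisect: "cub_a = cub_a3 + 2 * (fps_X * cub_c3)"
  using gen_plane_character[of "\<lambda>_. 1"] by (simp add: cub_a_def numeral_fps_const case_prod_unfold)

text \<open>Rotating the coordinates permutes the three classes of \<open>i - j\<close> modulo 3 cyclically.\<close>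

lemma cub_c_eq: "cub_c = 3 * cub_w"
proof -
  let ?P = "\<lambda>r::int. {(i, j, k) \<in> plane (-1). (i - j) mod 3 = r}"
  have *: "{s \<in> plane (-1). (case s of (i, j, k) \<Rightarrow> i - j) mod 3 = r} = ?P r" for r
    by auto
  have shift: "gen (?P r) tri3 (\<lambda>_. 1) = (gen (?P ((r + 1) mod 3)) tri3 (\<lambda>_. 1) :: 'a fps)"
    if "r \<in> {0, 1}" for r
    by (rule gen_reindex[where f = "\<lambda>(i, j, k). (j, k, i)" and g = "\<lambda>(i, j, k). (k, i, j)"])
       (use that in \<open>auto simp: plane_alt tri3_def; simp add: algebra_simps; presburger\<close>)+
  have w: "gen (?P 2) tri3 (\<lambda>_. 1) = (cub_w :: 'a fps)"
    unfolding cub_w_def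
    by (rule sym, rule gen_reindex[where f = "\<lambda>(i, j, k). (i - k - 1, k - j, j - i)"
          and g = "\<lambda>(i, j, k). let t = (j - i - 1) div 3 in (i + 1 + t, t - j, t)"])
       (auto simp: plane_alt Let_def tri3_def; (presburger | simp add: tri_expand algebra_simps))+
  have "cub_c = (gen (?P 0) tri3 (\<lambda>_. 1) + gen (?P 1) tri3 (\<lambda>_. 1) + gen (?P 2) tri3 (\<lambda>_. 1) :: 'a fps)"
    unfolding cub_c_def
    using gen_mod3[OF graded_tri3, of "plane (-1)" "\<lambda>_. 1" "\<lambda>(i, j, k). i - j"] by (simp add: *)
  then show ?thesis using shift[of 0] shift[of 1] w by simp
qed

section \<open>Product formulas for the cubic theta functions\<close>

lemma zpow_0 [simp]: "zpow 0 = 1"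
  by (simp add: zpow_def)

lemma lift_euler: "lift (euler m) = euler m"
  by (rule fps_map_euler[OF ring_map_single])

lemma ct_mult_euler: "ct (f * euler m) = euler m * ct f"
  using ct_lift_mult[of "euler m" f] by (simp add: lift_euler mult.commute)

lemma ct_theta:
  assumes "1 \<le> a" "0 \<le> g" "g \<le> a" "m \<noteq> 0"
  shows "ct (theta a g (\<lambda>s. zpow (m * s))) = 1"
proof -
  have "ct (theta a g (\<lambda>s. zpow (m * s))) = gen {s \<in> UNIV. m * s =
      0} (\<lambda>s. a * tri s - g * s) (\<lambda>_. 1 :: 'a)"
    unfolding theta_def zpow_def using assms by (intro ct_gen graded_tri)
  also have "{s \<in> UNIV. m * s = 0} = {0}" using assms by auto
  also have "gen {0} (\<lambda>s. a * tri s - g * s) (\<lambda>_. 1 :: 'a) = 1"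
  proof (rule fps_ext)
    fix n
    have "{s. s \<in> {0} \<and> a * tri s - g * s = int n} = (if n = 0 then {0} else {})" by auto
    then show "gen {0} (\<lambda>s. a * tri s - g * s) (\<lambda>_. 1 :: 'a) $ n = 1 $ n"
      by (simp add: gen_nth fps_one_nth)
  qed
  finally show ?thesis .
qed

text \<open>The constant term of F(z) is computed twice. The triple product gives 1 / E_1. Splitting
  the factors by their index modulo 3 gives three triple products in q^3, hence \<open>cub_w\<close>
  over E_3^3.\<close>

lemma cub_w_product: "cub_w * euler 1 = (euler 3 ^ 3 :: 'a::comm_ring_1 fps)"
proof -
  let ?z = "zpow :: int \<Rightarrow> int \<Rightarrow>\<^sub>0 'a"
  let ?J = "jacobi 1 0 ?z"
  have jt: "jacobi a g ?z * euler a = theta (int a) (int g) ?z" if "1 \<le> a" "g \<le> a" for a g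
    using that by (intro jacobi_triple) (simp_all add: zpow_mult)
  have one: "euler 1 * ct ?J = 1"
    using ct_mult_euler[of ?J 1] jt[of 1 0] ct_theta[of 1 0 1, where 'a = 'a] by simp
  have split: "?J = jacobi 3 2 ?z * jacobi 3 1 ?z * jacobi 3 0 ?z"
  proof -
    let ?p = "\<lambda>k. (1 + fps_const (?z 1) * fps_X ^ (1 * k + (1 - 0))) *
      (1 + fps_const (?z (- 1)) * fps_X ^ (1 * k + 0))"
    let ?q = "\<lambda>g k. (1 + fps_const (?z 1) * fps_X ^ (3 * k + (3 - g))) *
      (1 + fps_const (?z (- 1)) * fps_X ^ (3 * k + g))"
    have pq: "(\<lambda>k. ?p (3 * k) * ?p (3 * k + 1) * ?p (3 * k + 2)) = (\<lambda>k. ?q 2 k * ?q 1 k * ?q 0 k)"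
      by (rule ext) (simp add: mult_ac numeral_3_eq_3)
    have tq: "tame (?q g)" for g by (rule tame_jacobi) simp
    have "?J = iprod (\<lambda>k. ?p (3 * k) * ?p (3 * k + 1) * ?p (3 * k + 2))"
      unfolding jacobi_def by (rule iprod_trisect, rule tame_jacobi, simp, unfold pq, intro tame_mult tq)
    also have "\<dots> = iprod (?q 2) * iprod (?q 1) * iprod (?q 0)"
      unfolding pq using tq[of 2] tq[of 1] tq[of 0] by (simp only: iprod_mult tame_mult)
    finally show ?thesis unfolding jacobi_def by simp
  qed
  have g: "graded UNIV (\<lambda>i. 3 * tri i - 2 * i)" "graded UNIV (\<lambda>i. 3 * tri i - 1 * i)"
    "graded UNIV (\<lambda>i. 3 * tri i - 0 * i)"
    by (rule graded_tri; simp)+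
  have "euler 3 ^ 3 * ct ?J = ct (?J * euler 3 * euler 3 * euler 3)"
    by (simp only: ct_mult_euler) (simp add: power3_eq_cube mult_ac)
  also have "?J * euler 3 * euler 3 * euler 3 =
      (jacobi 3 2 ?z * euler 3) * (jacobi 3 1 ?z * euler 3) * (jacobi 3 0 ?z * euler 3)"
    unfolding split by (simp only: mult_ac)
  also have "\<dots> = theta 3 2 ?z * theta 3 1 ?z * theta 3 0 ?z"
    by (simp add: jt)
  also have "\<dots> = gen (UNIV \<times> UNIV \<times> UNIV) (\<lambda>(i, j, k). (3 * tri i - 2 * i) + (3 * tri j - 1 * j)
      + (3 * tri k - 0 * k))
       (\<lambda>(i, j, k). ?z i * ?z j * ?z k)"
    unfolding theta_def by (rule gen_Times3[OF g])
  also have "\<dots> = gen (UNIV \<times> UNIV \<times> UNIV) (\<lambda>(i, j, k). (3 * tri i - 2 * i) + (3 * tri j - 1 * j)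
      + (3 * tri k - 0 * k))
       (\<lambda>p. Poly_Mapping.single (case p of (i, j, k) \<Rightarrow> i + j + k) 1)"
    by (intro gen_cong) (auto simp: zpow_mult, simp add: zpow_def)
  also have "ct \<dots> = gen {p \<in> UNIV \<times> UNIV \<times> UNIV. (case p of (i, j, k) \<Rightarrow> i + j + k) = 0}
      (\<lambda>(i, j, k). (3 * tri i - 2 * i) + (3 * tri j - 1 * j) + (3 * tri k - 0 * k)) (\<lambda>_. 1)"
    by (rule ct_gen[OF graded_Times3[OF g]])
  also have "\<dots> = cub_w"
    unfolding cub_w_def by (rule gen_cong) (auto simp: plane_def)
  finally have "euler 3 ^ 3 * (euler 1 * ct ?J) = cub_w * euler 1"
    by (simp add: mult_ac)
  with one show ?thesis by simp
qed

lemma cubic_factor: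
  fixes w a :: "'a::comm_ring_1"
  assumes "1 + w + w * w = 0"
  shows "(1 + w * a) * (1 + w * w * a) * (1 + a) = 1 + a ^ 3"
proof -
  have "w * w * w - 1 = (w - 1) * (1 + w + w * w)"
    by (simp add: algebra_simps)
  then have w3: "w * w * w = 1" by (simp add: assms)
  have "(1 + w * a) * (1 + w * w * a) * (1 + a) =
      1 + (1 + w + w * w) * a + w * (1 + w + w * w) * (a * a) + (w * w * w) * a ^ 3"
    by (simp add: algebra_simps power3_eq_cube)
  then show ?thesis by (simp add: assms w3)
qed

text \<open>The constant term of F(omega z) F(omega^2 z) F(z) is computed twice. As F(z^3; q^3) it
  is 1 / E_3. As a product of three theta series over E_1^3 it is an A2 sum with a cubic character,
  where omega + omega^2 = -1.\<close>

lemma cub_b_product_complex: "(cub_a3 - fps_X * cub_c3) * euler 3 = (euler 1 ^ 3 :: complex fps)"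
proof -
  define \<omega> where "\<omega> = cis (2 * pi / 3)"
  have w3: "\<omega> ^ 3 = 1" unfolding \<omega>_def by (simp add: DeMoivre)
  have "\<omega> \<noteq> 1" by (simp add: \<omega>_def complex_eq_iff cos_120)
  moreover have "(\<omega> - 1) * (1 + \<omega> + \<omega> * \<omega>) = 0"
    using w3 by (simp add: algebra_simps power3_eq_cube)
  ultimately have w: "1 + \<omega> + \<omega> * \<omega> = 0" by simp
  have w0: "\<omega> \<noteq> 0" by (simp add: \<omega>_def)
  \<comment> \<open>The powers of omega^m z.\<close>
  define \<zeta> where "\<zeta> m s = Poly_Mapping.single s (\<omega> powi (m * s))" for m s :: int
  have \<zeta>: "\<zeta> m (s + t) = \<zeta> m s * \<zeta> m t" "\<zeta> m 0 = 1" for m s t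
    by (simp_all add: \<zeta>_def mult_single distrib_left power_int_add w0)
  let ?J = "\<lambda>m. jacobi 1 0 (\<zeta> m)" and ?z = "\<lambda>s::int. zpow (3 * s) :: int \<Rightarrow>\<^sub>0 complex"
  let ?P = "?J 1 * ?J 2 * ?J 0"
  have P: "?P = jacobi 3 0 ?z"
  proof -
    let ?p = "\<lambda>m k. (1 + fps_const (\<zeta> m 1) * fps_X ^ (1 * k + (1 - 0))) *
      (1 + fps_const (\<zeta> m (- 1)) * fps_X ^ (1 * k + 0))"
    have t: "tame (?p m)" for m by (rule tame_jacobi) simp
    let ?c = "\<lambda>x. fps_const (Poly_Mapping.single 0 x) :: (int \<Rightarrow>\<^sub>0 complex) fps"
    have inv: "inverse \<omega> = \<omega> * \<omega>" "inverse (\<omega> * \<omega>) = \<omega>"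
      using w3 w0 by (simp_all add: field_simps power3_eq_cube)
    have w4: "\<omega> * \<omega> * (\<omega> * \<omega>) = \<omega>"
      using w3 by (simp add: power3_eq_cube mult.assoc)
    have up: "fps_const (\<zeta> 1 1) = ?c \<omega> * fps_const (zpow 1)" "fps_const (\<zeta> 2 1) =
        ?c \<omega> * ?c \<omega> * fps_const (zpow 1)"
        "fps_const (\<zeta> 0 1) = fps_const (zpow 1)"
      by (simp_all add: \<zeta>_def zpow_def mult_single power2_eq_square)
    have down: "fps_const (\<zeta> 1 (-1)) = ?c \<omega> * ?c \<omega> * fps_const (zpow (-1))"
        "fps_const (\<zeta> 2 (-1)) = ?c \<omega> * fps_const (zpow (-1))"
        "fps_const (\<zeta> 0 (-1)) = fps_const (zpow (-1))"
      by (simp_all add: \<zeta>_def zpow_def mult_single power_int_minus power2_eq_square inv w4)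
    have c: "1 + ?c \<omega> + ?c \<omega> * ?c \<omega> = 0"
    proof -
      have "1 + ?c \<omega> + ?c \<omega> * ?c \<omega> = ?c (1 + \<omega> + \<omega> * \<omega>)"
        by (simp add: mult_single single_add flip: fps_const_add)
      then show ?thesis using w by simp
    qed
    have z3: "fps_const (zpow s) ^ 3 = (fps_const (zpow (3 * s)) :: (int \<Rightarrow>\<^sub>0 complex) fps)" for s
      by (simp add: fps_const_power zpow_power mult.commute)
    have pq: "?p 1 k * ?p 2 k * ?p 0 k = (1 + fps_const (?z 1) * fps_X ^ (3 * k + (3 - 0))) *
        (1 + fps_const (?z (- 1)) * fps_X ^ (3 * k + 0))" for k
    proof -
      let ?a = "fps_const (zpow 1) * fps_X ^ (k + 1) :: (int \<Rightarrow>\<^sub>0 complex) fps"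
      let ?b = "fps_const (zpow (-1)) * fps_X ^ k :: (int \<Rightarrow>\<^sub>0 complex) fps"
      have e: "(k + 1) * 3 = 3 * k + (3 - 0)" "k * 3 = 3 * k + 0" by simp_all
      have "?p 1 k * ?p 2 k * ?p 0 k = ((1 + ?c \<omega> * ?a) * (1 + ?c \<omega> * ?c \<omega> * ?a) * (1 + ?a)) *
          ((1 + ?c \<omega> * ?b) * (1 + ?c \<omega> * ?c \<omega> * ?b) * (1 + ?b))"
        unfolding up down by (simp only: mult_1 diff_zero add_0_right mult_ac)
      also have "\<dots> = (1 + ?a ^ 3) * (1 + ?b ^ 3)"
        unfolding cubic_factor[OF c] ..
      also have "?a ^ 3 = fps_const (?z 1) * fps_X ^ (3 * k + (3 - 0))"
        unfolding power_mult_distrib z3 power_mult[symmetric] e ..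
      also have "?b ^ 3 = fps_const (?z (-1)) * fps_X ^ (3 * k + 0)"
        unfolding power_mult_distrib z3 power_mult[symmetric] e ..
      finally show ?thesis .
    qed
    have "?P = iprod (\<lambda>k. ?p 1 k * ?p 2 k * ?p 0 k)"
      unfolding jacobi_def by (simp only: iprod_mult tame_mult t)
    then show ?thesis unfolding pq by (simp only: jacobi_def)
  qed
  have "?P * euler 3 = theta (int 3) (int 0) ?z"
    unfolding P by (rule jacobi_triple) (simp_all add: zpow_mult distrib_left)
  then have one: "euler 3 * ct ?P = 1"
    using ct_mult_euler[of ?P 3] ct_theta[of 3 0 3, where 'a = complex] by simp
  have th: "?J m * euler 1 = theta 1 0 (\<zeta> m)" for m
    using jacobi_triple[of 1 0 "\<zeta> m"] \<zeta> by simp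
  have "euler 1 ^ 3 * ct ?P = ct (?P * euler 1 * euler 1 * euler 1)"
    by (simp only: ct_mult_euler) (simp add: power3_eq_cube mult_ac)
  also have "?P * euler 1 * euler 1 * euler 1 = (?J 1 * euler 1) * (?J 2 * euler 1) * (?J 0 * euler 1)"
    by (simp only: mult_ac)
  also have "\<dots> = gen UNIV tri (\<zeta> 1) * gen UNIV tri (\<zeta> 2) * gen UNIV tri (\<zeta> 0)"
    unfolding th by (simp add: theta_def)
  also have "\<dots> = gen (UNIV \<times> UNIV \<times> UNIV) (\<lambda>(i, j, k). tri i + tri j
      + tri k) (\<lambda>(i, j, k). \<zeta> 1 i * \<zeta> 2 j * \<zeta> 0 k)"
    by (rule gen_Times3[OF graded_tri1 graded_tri1 graded_tri1])
  also have "\<dots> = gen UNIV tri3 (\<lambda>p. Poly_Mapping.single (case p of (i, j, k) \<Rightarrow> i + j + k)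
      (case p of (i, j, k) \<Rightarrow> \<omega> powi ((i - j) mod 3)))"
  proof (intro gen_cong)
    fix p :: "int \<times> int \<times> int"
    obtain i j k where p: "p = (i, j, k)" by (cases p)
    \<comment> \<open>The characters for m = 1, 2, 0 give the exponent i + 2j, which differs from i
      - j by 3j.\<close>
    have "i + 2 * j = 3 * (j + (i - j) div 3) + (i - j) mod 3"
      by presburger
    then have "\<omega> powi (i + 2 * j) = \<omega> powi (3 * (j + (i - j) div 3)) * \<omega> powi ((i - j) mod 3)"
      using power_int_add[of \<omega>] w0 by (simp only: simp_thms)
    also have "\<omega> powi (3 * (j + (i - j) div 3)) = 1"
      unfolding power_int_mult using w3 by simp
    finally have e: "\<omega> powi (i + 2 * j) = \<omega> powi ((i - j) mod 3)" by simp
    show "(case p of (i, j, k) \<Rightarrow> \<zeta> 1 i * \<zeta> 2 j * \<zeta> 0 k) = Poly_Mapping.single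
        (case p of (i, j, k) \<Rightarrow> i + j + k) (case p of (i, j, k) \<Rightarrow> \<omega> powi ((i - j) mod 3))"
      unfolding e[symmetric] p by (simp add: \<zeta>_def mult_single e[symmetric] power_int_add w0)
  qed (auto simp: tri3_def)
  also have "ct \<dots> = gen {p \<in> UNIV. (case p of (i, j, k) \<Rightarrow> i + j + k) = 0} tri3
      (\<lambda>(i, j, k). \<omega> powi ((i - j) mod 3))"
    by (rule ct_gen[OF graded_tri3])
  also have "{p \<in> UNIV. (case p of (i, j, k) \<Rightarrow> i + j + k) = 0} = plane 0"
    by (auto simp: plane_def)
  also have "gen (plane 0) tri3 (\<lambda>(i, j, k). \<omega> powi ((i - j) mod 3)) =
      cub_a3 + fps_const (\<omega> + \<omega> * \<omega>) * (fps_X * cub_c3)"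
    by (subst gen_plane_character) (simp add: power2_eq_square)
  also have "\<omega> + \<omega> * \<omega> = -1" using w by (simp add: add_eq_0_iff algebra_simps)
  also have "cub_a3 + fps_const (- 1) * (fps_X * cub_c3) = cub_a3 - fps_X * (cub_c3 :: complex fps)"
    by (simp flip: fps_const_neg)
  finally have b: "cub_a3 - fps_X * cub_c3 = euler 1 ^ 3 * ct ?P" ..
  have "(cub_a3 - fps_X * cub_c3) * euler 3 = euler 1 ^ 3 * (euler 3 * ct ?P)"
    unfolding b by (simp only: mult_ac)
  with one show ?thesis by simp
qed

lemma ring_map_of_int: "ring_map (of_int :: int \<Rightarrow> complex)"
  by (simp add: ring_map_def)

text \<open>Both sides have integer coefficients, and the integers embed into the complex numbers.
  The congruences require the identity over the integers.\<close>

lemma cub_b_product: "(cub_a3 - fps_X * cub_c3) * euler 3 = (euler 1 ^ 3 :: int fps)"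
proof -
  let ?h = "fps_map (of_int :: int \<Rightarrow> complex)"
  note H = ring_map_fps_map[OF ring_map_of_int]
  have "?h ((cub_a3 - fps_X * cub_c3) * euler 3) = ?h (euler 1 ^ 3)"
    using cub_b_product_complex
    by (simp add: ring_map_simps[OF H] ring_map_power[OF H] fps_map_euler[OF ring_map_of_int]
        cub_a3_def X_cub_c3 fps_map_gen[OF ring_map_of_int])
  then show ?thesis by (auto simp: fps_eq_iff simp del: of_int_power)
qed

section \<open>Congruences\<close>

abbreviation dilate :: "int fps \<Rightarrow> int fps" where
  "dilate f \<equiv> f oo fps_X ^ 3"

lemma ring_map_dilate: "ring_map dilate"
  by (simp add: ring_map_def fps_compose_add_distrib fps_compose_mult_distrib)

lemma cong_X_dilate: "cong_X N f g \<Longrightarrow> cong_X N (dilate f) (dilate g)"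
  unfolding cong_X_def fps_nth_compose_X_power using le_less_trans[OF div_le_dividend] by auto

lemma dilate_euler: "dilate (euler m) = euler (3 * m)" if "m \<ge> 1"
proof (rule cong_X_all_imp_eq)
  fix N
  note H = ring_map_simps[OF ring_map_dilate] ring_map_power[OF ring_map_dilate] ring_map_prod[OF
      ring_map_dilate]
  have "dilate fps_X = fps_X ^ 3"
    by (simp add: fps_X_fps_compose_startby0)
  then have "dilate (\<Prod>k<N. 1 - fps_X ^ (m * (k + 1))) = (\<Prod>k<N. 1 - fps_X ^ (3 * m * (k + 1)))"
    unfolding H by (simp add: mult.assoc flip: power_mult)
  moreover have "cong_X N (dilate (euler m)) (dilate (\<Prod>k<N. 1 - fps_X ^ (m * (k + 1))))"
    unfolding euler_def by (intro cong_X_dilate iprod_cong_X tame_euler that)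
  ultimately show "cong_X N (dilate (euler m)) (euler (3 * m))"
    using cong_X_sym[OF iprod_cong_X[OF tame_euler[of "3 * m"], of N]] that
    by (auto simp: euler_def intro: cong_X_trans)
qed

text \<open>Substituting c = 3w in the constant term produces the constants: 6 * 9 = 54 and 2 * 27 *
  3 = 54 * 3.\<close>

lemma cphi_9_cubic:
  "Abs_fps (\<lambda>n. int (cphi 9 n)) * euler 1 ^ 9 = cub_a ^ 3 * cub_a3
    + 54 * (fps_X * cub_w ^ 3) * (cub_a + 3 * (fps_X * dilate cub_w))"
proof -
  let ?J = "jacobi 1 0 zpow :: (int \<Rightarrow>\<^sub>0 int) fps"
  note H = ring_map_power[OF ring_map_fps_map[OF ring_map_single]]
  have th: "?J * euler 1 = theta 1 0 zpow"
    using jacobi_triple[of 1 0 "zpow :: int \<Rightarrow> int \<Rightarrow>\<^sub>0 int"] by (simp add: zpow_mult)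
  have "Abs_fps (\<lambda>n. int (cphi 9 n)) * euler 1 ^ 9 = euler 1 ^ 9 * ct (?J ^ 9)"
    by (subst cphi_generating_function) (simp add: mult.commute)
  also have "\<dots> = ct (lift (euler 1 ^ 9) * ?J ^ 9)"
    by (rule ct_lift_mult[symmetric])
  also have "lift (euler 1 ^ 9) * ?J ^ 9 = theta 1 0 zpow ^ 9"
    unfolding th[symmetric] H lift_euler by (simp add: power_mult_distrib mult.commute)
  also have "ct \<dots> = cub_a ^ 3 * cub_a3 + 6 * cub_a * (3 * cub_w) ^ 2 * (fps_X * cub_w)
     + 2 * (3 * cub_w) ^ 3 * (fps_X ^ 2 * cub_c3)"
    unfolding ct_theta_power9 cub_c_eq ..
  also have "cub_c3 = 3 * dilate cub_w"
  proof -
    have "cub_c3 = dilate cub_c"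
      by (simp add: cub_c_def cub_c3_def gen_dilate)
    then show ?thesis
      unfolding cub_c_eq by (simp add: ring_map_simps[OF ring_map_dilate] numeral_fps_const
          fps_compose_mult_distrib)
  qed
  finally show ?thesis
    by (simp add: algebra_simps power2_eq_square power3_eq_cube)
qed

lemma fps_numeral_mult_nth: "(numeral k * f) $ n = numeral k * (f $ n :: 'a::comm_ring_1)"
  by (simp add: numeral_fps_const)

lemma fps_dvdI:
  fixes f :: "int fps"
  assumes "\<And>n. numeral k dvd f $ n"
  shows "\<exists>g. f = numeral k * g"
  by (rule exI[of _ "Abs_fps (\<lambda>n. f $ n div numeral k)"])
     (use assms in \<open>simp add: fps_eq_iff fps_numeral_mult_nth\<close>)

text \<open>Here \<open>x = q\<^sup>*a\<close>, \<open>d = q\<^sup>*b\<close> and \<open>u = q\<^sup>*w\<close> for the substitution \<open>q\<^sup>*: q \<mapsto> q\<^sup>3\<close>.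
  Borwein's identity \<open>a\<^sup>3 = b\<^sup>3 + c\<^sup>3\<close> is only needed modulo 729. There it is free: \<open>x\<close> is congruent to \<open>d\<close>
  modulo 9, so their cubes agree modulo 27.\<close>

lemma cubic_congruence:
  fixes X a b x d Y Z K w u e1 e3 e9 i1 i3 B \<Phi> :: "'a::comm_ring_1"
  assumes Phi: "\<Phi> * e1 ^ 9 = a ^ 3 * x + 54 * K * (a + 3 * Y)"
    and b: "b = x - 3 * Y" and a: "a = x + 6 * Y" and x: "x = d + 9 * Z"
    and Y: "Y = X * u" and K: "K = X * w ^ 3"
    and be: "b * e3 = e1 ^ 3" and de: "d * e9 = e3 ^ 3" and we: "w * e1 = e3 ^ 3" and ue: "u * e3 =
        e9 ^ 3"
    and i1: "e1 * i1 = 1" and i3: "e3 * i3 = 1" and B: "b = 1 + 3 * B"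
  shows "\<exists>H. \<Phi> = x * i3 ^ 3 + 81 * (X * e3 ^ 5) + 729 * H"
proof -
  define Q where "Q = x ^ 2 + 3 * x * Y + 9 * Y ^ 2"
  define R where "R = d ^ 2 * Z + 9 * d * Z ^ 2 + 27 * Z ^ 3"
  have p1: "e1 ^ n * i1 ^ n = 1" and p3: "e3 ^ n * i3 ^ n = 1" for n
    using i1 i3 by (simp_all flip: power_mult_distrib)
  \<comment> \<open>The powers of E_1 cancel in q w^3 b, since w^3 = E_3^9 / E_1^3 and b = E_1^3 /
    E_3.\<close>
  have "K * b * e3 = X * (w * e1) ^ 3"
    using be by (simp add: K power_mult_distrib mult.assoc)
  also have "\<dots> = X * e3 ^ 8 * e3"
    unfolding we by (simp add: mult.assoc flip: power_mult power_Suc2)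
  finally have "K * b * e3 * i3 = X * e3 ^ 8 * e3 * i3" by simp
  then have Kb: "K * b = X * e3 ^ 8" using i3 by (simp add: mult.assoc)
  have e9: "e3 ^ 9 = e3 ^ 8 * e3" by (simp flip: power_Suc2)
  have bQ: "b * Q = x ^ 3 - 27 * Y ^ 3"
    unfolding b Q_def by (simp add: algebra_simps power2_eq_square power3_eq_cube)
  have x3: "x ^ 3 = d ^ 3 + 27 * R"
    unfolding x R_def by (simp add: algebra_simps power2_eq_square power3_eq_cube)
  \<comment> \<open>The aim is K = YQ modulo 27. Writing E_3^9 as (d E_9)^3 brings in d^3, which is
    x^3 - 27 Y^3 = bQ modulo 27; then K b is known.\<close>
  have "K * e3 ^ 9 = K * (d * e9) ^ 3"
    unfolding de by (simp flip: power_mult)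
  also have "\<dots> = e9 ^ 3 * (K * d ^ 3)"
    by (simp add: power_mult_distrib mult_ac)
  also have "d ^ 3 = b * Q + 27 * (Y ^ 3 - R)"
    using x3 bQ by (simp add: algebra_simps)
  also have "e9 ^ 3 * (K * (b * Q + 27 * (Y ^ 3 - R))) =
      e9 ^ 3 * (K * b) * Q + 27 * (e9 ^ 3 * K * (Y ^ 3 - R))"
    by (simp add: algebra_simps)
  also have "e9 ^ 3 * (K * b) = Y * e3 ^ 9"
    unfolding Kb ue[symmetric] Y e9 by (simp add: mult_ac)
  finally have "K * e3 ^ 9 * i3 ^ 9 = (Y * e3 ^ 9 * Q + 27 * (e9 ^ 3 * K * (Y ^ 3 - R))) * i3 ^ 9"
    by simp
  also have "\<dots> = Y * Q * (e3 ^ 9 * i3 ^ 9) + 27 * (e9 ^ 3 * K * (Y ^ 3 - R) * i3 ^ 9)"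
    by (simp add: algebra_simps)
  finally have "K = Y * Q + 27 * (e9 ^ 3 * K * (Y ^ 3 - R) * i3 ^ 9)"
    using p3[of 9] by (simp add: mult.assoc)
  then obtain M where M: "K = Y * Q + 27 * M" by blast
  have a3: "a ^ 3 = b ^ 3 + 27 * (Y * Q)"
    unfolding a b Q_def by (simp add: algebra_simps power2_eq_square power3_eq_cube)
  \<comment> \<open>The total coefficient of K is 27x + 54(x + 9Y) = 81b + 729Y, so the factor 81
    comes out and K b can be inserted.\<close>
  have "\<Phi> * e1 ^ 9 = (b ^ 3 + 27 * (K - 27 * M)) * x + 54 * K * (a + 3 * Y)"
    unfolding Phi a3 using M by simp
  also have "\<dots> = b ^ 3 * x + 81 * (K * b) + 729 * (K * Y - M * x)"
    unfolding a b by (simp add: algebra_simps)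
  also have "b ^ 3 = e1 ^ 9 * i3 ^ 3"
  proof -
    have "e1 ^ 9 * i3 ^ 3 = (e1 ^ 3) ^ 3 * i3 ^ 3" by (simp flip: power_mult)
    also have "\<dots> = b ^ 3 * (e3 ^ 3 * i3 ^ 3)"
      unfolding be[symmetric] by (simp add: power_mult_distrib mult.assoc)
    finally show ?thesis using p3[of 3] by simp
  qed
  finally have "\<Phi> * e1 ^ 9 * i1 ^ 9 =
      (e1 ^ 9 * i3 ^ 3 * x + 81 * (X * e3 ^ 8) + 729 * (K * Y - M * x)) * i1 ^ 9"
    unfolding Kb by simp
  also have "\<dots> = x * i3 ^ 3 * (e1 ^ 9 * i1 ^ 9) + 81 * (X * e3 ^ 8 * i1 ^ 9)
      + 729 * ((K * Y - M * x) * i1 ^ 9)"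
    by (simp add: algebra_simps)
  finally have P: "\<Phi> = x * i3 ^ 3 + 81 * (X * (e3 ^ 8 * i1 ^ 9)) + 729 * ((K * Y - M * x) * i1 ^ 9)"
    using p1[of 9] by (simp add: mult.assoc)
  \<comment> \<open>Behind the factor 81 only the residue modulo 9 of E_3^8 / E_1^9 matters. It is
    that of E_3^5, because E_1^9 = b^3 E_3^3 and b = 1 modulo 3 makes b^3 = 1 modulo 9.\<close>
  define B' where "B' = B + 3 * B ^ 2 + 3 * B ^ 3"
  have "b ^ 3 = 1 + 9 * B'"
    unfolding B B'_def by (simp add: algebra_simps power2_eq_square power3_eq_cube)
  have "e3 ^ 5 * e1 ^ 9 * i1 ^ 9 = e3 ^ 5 * (b * e3) ^ 3 * i1 ^ 9"
    unfolding be by (simp flip: power_mult)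
  also have "\<dots> = e3 ^ 8 * i1 ^ 9 * b ^ 3"
    by (simp add: power_mult_distrib mult_ac flip: power_add)
  also have "\<dots> = e3 ^ 8 * i1 ^ 9 + 9 * (e3 ^ 8 * i1 ^ 9 * B')"
    unfolding \<open>b ^ 3 = 1 + 9 * B'\<close> by (simp add: algebra_simps)
  finally have "e3 ^ 8 * i1 ^ 9 = e3 ^ 5 - 9 * (e3 ^ 8 * i1 ^ 9 * B')"
    using p1[of 9] by (simp add: mult.assoc)
  then have "\<Phi> = x * i3 ^ 3 + 81 * (X * (e3 ^ 5 - 9 * (e3 ^ 8 * i1 ^ 9 * B')))
      + 729 * ((K * Y - M * x) * i1 ^ 9)"
    using P by simp
  also have "\<dots> = x * i3 ^ 3 + 81 * (X * e3 ^ 5)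
      + 729 * ((K * Y - M * x) * i1 ^ 9 - X * (e3 ^ 8 * i1 ^ 9 * B'))"
    by (simp add: algebra_simps)
  finally show ?thesis by blast
qed

text \<open>Here \<open>f\<close> is a / E_1^3 and \<open>g\<close> is E_1^5; the dilation turns
  them into x / E_3^3 and E_3^5.\<close>

lemma cphi_9_mod_729:
  obtains f g h :: "int fps"
  where "\<And>n. int (cphi 9 n) = dilate f $ n + 81 * (fps_X * dilate g) $ n + 729 * h $ n"
    and "\<And>n. \<not> 3 dvd n \<Longrightarrow> 9 dvd f $ n"
proof -
  note D = ring_map_simps[OF ring_map_dilate] ring_map_power[OF ring_map_dilate]
  define Y where "Y = fps_X * dilate cub_w"
  define b where "b = cub_a3 - 3 * Y"
  have D3: "dilate 3 = 3" "dilate 9 = 9" by (simp_all add: numeral_fps_const)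
  have x: "cub_a3 = dilate cub_a"
    by (simp add: cub_a_def cub_a3_def gen_dilate)
  have "cub_c3 = dilate (3 * cub_w)"
    unfolding cub_c_eq[symmetric] by (simp add: cub_c_def cub_c3_def gen_dilate)
  then have c3: "fps_X * cub_c3 = 3 * Y"
    by (simp add: D D3 Y_def)
  have a: "cub_a = cub_a3 + 6 * Y"
    using cub_a_trisect[where 'a = int] unfolding c3 by simp
  have ab: "cub_a = b + 9 * Y" by (simp add: a b_def)
  have e3: "dilate (euler 1) = euler 3"
    using dilate_euler[of 1] by simp
  have be: "b * euler 3 = euler 1 ^ 3"
    using cub_b_product unfolding c3 b_def .
  have de: "dilate b * dilate (euler 3) = euler 3 ^ 3"
    using arg_cong[OF be, of dilate] by (simp add: D e3[unfolded One_nat_def])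
  have ue: "dilate cub_w * euler 3 = dilate (euler 3) ^ 3"
    using arg_cong[OF cub_w_product, of dilate] by (simp add: D e3[unfolded One_nat_def])
  obtain i1 :: "int fps" where i1: "euler 1 * i1 = 1"
    using fps_right_inverse_exists[OF euler_nth_0[of 1]] by auto
  have i3: "euler 3 * dilate i1 = 1"
    using arg_cong[OF i1, of dilate] by (simp add: D e3[unfolded One_nat_def])
  have b0: "b $ 0 = 1"
  proof -
    have "(b * euler 3) $ 0 = (euler 1 ^ 3) $ 0" unfolding be ..
    then show ?thesis by (simp add: euler_nth_0 fps_nth_power_0)
  qed
  \<comment> \<open>Modulo 3 the series a(q) and a(q^3) agree, so a nonzero exponent descends to a
    third of itself or has coefficient 0; the constant term is 1.\<close>
  have dvd: "3 dvd (cub_a - 1 :: int fps) $ n" for n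
  proof (induction n rule: less_induct)
    case (less n)
    show ?case
    proof (cases "n = 0")
      case True
      then show ?thesis by (simp add: ab b0 Y_def)
    next
      case False
      have "(cub_a - 1 :: int fps) $ n = (if 3 dvd n then cub_a $ (n div 3) else 0) + 3 * (2 * Y $ n)"
        by (subst a) (use False in \<open>simp add: x fps_nth_compose_X_power fps_numeral_mult_nth\<close>)
      moreover have "3 dvd (cub_a :: int fps) $ (n div 3)" if "3 dvd n"
        using less.IH[of "n div 3"] False that by auto
      ultimately show ?thesis by auto
    qed
  qed
  have "\<exists>A. cub_a - 1 = 3 * (A :: int fps)"
    by (rule fps_dvdI) (rule dvd)
  then obtain A where A: "cub_a - 1 = 3 * (A :: int fps)" ..
  have "b = (cub_a - 1) + 1 - 9 * Y" by (simp add: ab)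
  then have B: "b = 1 + 3 * (A - 3 * Y)"
    unfolding A by (simp add: algebra_simps)
  have xd: "cub_a3 = dilate b + 9 * dilate Y"
    unfolding x ab by (simp add: D D3)
  obtain H where H: "Abs_fps (\<lambda>n. int (cphi 9 n)) =
      cub_a3 * dilate i1 ^ 3 + 81 * (fps_X * euler 3 ^ 5) + 729 * H"
    using cubic_congruence[OF cphi_9_cubic[folded Y_def] b_def a xd Y_def refl be de cub_w_product
        ue i1 i3 B]
    by blast
  show ?thesis
  proof
    fix n
    have "cub_a3 * dilate i1 ^ 3 = dilate (cub_a * i1 ^ 3)" "euler 3 ^ 5 = dilate (euler 1 ^ 5)"
      by (simp_all add: D x e3[unfolded One_nat_def])
    then show "int (cphi 9 n) =
        dilate (cub_a * i1 ^ 3) $ n + 81 * (fps_X * dilate (euler 1 ^ 5)) $ n + 729 * H $ n"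
      using arg_cong[OF H, of "\<lambda>f. f $ n"] by (simp add: fps_numeral_mult_nth)
  next
    fix n :: nat assume n: "\<not> 3 dvd n"
    \<comment> \<open>The product formula turns b / E_1^3 into 1 / E_3, a series in q^3; passing
      from b to \<open>cub_a\<close> costs a multiple of 9.\<close>
    have "b * i1 ^ 3 = b * (euler 3 * dilate i1) * i1 ^ 3" using i3 by simp
    also have "\<dots> = (euler 1 * i1) ^ 3 * dilate i1"
      using be by (simp add: power_mult_distrib mult_ac)
    finally have "cub_a * i1 ^ 3 = dilate i1 + 9 * (Y * i1 ^ 3)"
      unfolding ab i1 by (simp add: algebra_simps)
    then show "9 dvd (cub_a * i1 ^ 3) $ n"
      using n by (simp add: fps_nth_compose_X_power fps_numeral_mult_nth)
  qed
qed

theorem theorem5p2: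
  fixes n :: nat
  shows "[cphi 9 (9 * n + 3) = 0] (mod 9) \<and> [cphi 9 (9 * n + 6) = 0] (mod 9) \<and>
         [cphi 9 (3 * n + 1) = 0] (mod 81) \<and> [cphi 9 (3 * n + 2) = 0] (mod 729)"
proof -
  obtain f g h :: "int fps"
    where eq: "\<And>n. int (cphi 9 n) = dilate f $ n + 81 * (fps_X * dilate g) $ n + 729 * h $ n"
      and f: "\<And>n. \<not> 3 dvd n \<Longrightarrow> 9 dvd f $ n"
    by (rule cphi_9_mod_729) blast
  have nine: "9 dvd cphi 9 (3 * m)" if "\<not> 3 dvd m" for m
  proof -
    have "int (cphi 9 (3 * m)) = f $ m + 9 * (9 * (fps_X * dilate g) $ (3 * m) + 81 * h $ (3 * m))"
      unfolding eq by (simp add: fps_nth_compose_X_power)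
    then have "9 dvd int (cphi 9 (3 * m))" using f[OF that] by simp
    then show ?thesis by presburger
  qed
  have "\<not> 3 dvd 3 * n + 1" "\<not> 3 dvd 3 * n + 2" by presburger+
  then have "9 dvd cphi 9 (9 * n + 3)" "9 dvd cphi 9 (9 * n + 6)"
    using nine[of "3 * n + 1"] nine[of "3 * n + 2"] by (simp_all add: algebra_simps)
  moreover have "81 dvd cphi 9 (3 * n + 1)"
  proof -
    have "\<not> 3 dvd 3 * n + 1" by presburger
    then have "int (cphi 9 (3 * n + 1)) = 81 * ((fps_X * dilate g) $ (3 * n + 1) + 9 * h $ (3 * n + 1))"
      unfolding eq by (simp add: fps_nth_compose_X_power)
    then have "81 dvd int (cphi 9 (3 * n + 1))" by simp
    then show ?thesis by presburger
  qed
  moreover have "729 dvd cphi 9 (3 * n + 2)"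
  proof -
    have "\<not> 3 dvd 3 * n + 2" "\<not> 3 dvd 3 * n + 1" by presburger+
    \<comment> \<open>The factor \<open>fps_X\<close> lowers the exponent in the second term to 3n +
      1, so neither series in q^3 contributes.\<close>
    then have "int (cphi 9 (3 * n + 2)) = 729 * h $ (3 * n + 2)"
      unfolding eq by (simp add: fps_nth_compose_X_power)
    then have "729 dvd int (cphi 9 (3 * n + 2))" by simp
    then show ?thesis by presburger
  qed
  ultimately show ?thesis by (simp add: cong_0_iff)
qed

end
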